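(* Let $(X,d,\mu)$ be a metric measure space such that $\sup\{\mu(B(x,1)):x\in X\}<\infty$ and $h(r):=\inf\{\mu(B(x,r)):x\in X\}>0$ for all $r\in(0,1)$. Then the following statements are equivalent: (i) $\mu(X)<\infty$; (ii) for every $p,s\in\mathcal{P}_b(X)$ and $q\in\mathcal{P}(X)$ we have the compact embeddings $$M^{s(\cdot)}_{p(\cdot),q(\cdot)}(X,d,\mu)\hookrightarrow\hookrightarrow L^{p(\cdot)}(X,\mu),\qquad N^{s(\cdot)}_{p(\cdot),q(\cdot)}(X,d,\mu)\hookrightarrow\hookrightarrow L^{p(\cdot)}(X,\mu);$$ (iii) there exist $p,s,\beta\in\mathcal{P}_b(X)$ and $q\in\mathcal{P}(X)$, satisfying either $s^+<1$ and $q^-<\infty$, or $s^+\le1$ and $q^-=\infty$, such that at least one of the following compact embeddings holds: $$M^{s(\cdot)}_{p(\cdot),q(\cdot)}(X,d,\mu)\hookrightarrow\hookrightarrow L^{\beta(\cdot)}(X,\mu),\qquad N^{s(\cdot)}_{p(\cdot),q(\cdot)}(X,d,\mu)\hookrightarrow\hookrightarrow L^{\beta(\cdot)}(X,\mu).$$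
   Context: A metric measure space $(X,d,\mu)$ is a metric space $(X,d)$ with a Borel measure $\mu$ such that $0<\mu(B(x,r))<\infty$ for every open ball $B(x,r)$, $x\in X$, $r\in(0,\infty)$ (in particular $X$ is separable). Exponents: for measurable $p$ on $X$, $p^+=\operatorname{ess\,sup}_X p$, $p^-=\operatorname{ess\,inf}_X p$. $\mathcal{P}(X)$ is the set of measurable $p:X\to(0,\infty]$ with $p^->0$; $\mathcal{P}_b(X)=\mathcal{P}(X)\cap L^\infty(X,\mu)$. Lebesgue spaces: for $p\in\mathcal{P}_b(X)$ let $\rho_{p(\cdot)}(u)=\int_X|u(x)|^{p(x)}\,d\mu(x)$. $L^{p(\cdot)}(X,\mu)$ is the space of measurable $u$ with $\rho_{p(\cdot)}(\lambda u)<\infty$ for some $\lambda>0$, with quasi-norm $\|u\|_{L^{p(\cdot)}}=\inf\{\lambda>0:\rho_{p(\cdot)}(u/\lambda)\le1\}$. Mixed spaces ($p\in\mathcal{P}_b(X)$, $q\in\mathcal{P}(X)$): for sequences $\{u_k\}_{k\in\mathbb{Z}}$ of measurable functions, $\|\{u_k\}\|_{L^{p(\cdot)}(\ell^{q(\cdot)})}=\big\|\,\|\{u_k(\cdot)\}_k\|_{\ell^{q(\cdot)}}\big\|_{L^{p(\cdot)}}$ (pointwise $\ell^{q(x)}(\mathbb{Z})$ quasi-norm, supremum if $q(x)=\infty$). Let $\rho_{\ell^{q(\cdot)}(L^{p(\cdot)})}(\{u_k\})=\sum_{k\in\mathbb{Z}}\inf\{\lambda_k>0:\rho_{p(\cdot)}(u_k/\lambda_k^{1/q(\cdot)})\le1\}$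 (with $\lambda^{1/\infty}=1$) and $\|\{u_k\}\|_{\ell^{q(\cdot)}(L^{p(\cdot)})}=\inf\{m>0:\rho_{\ell^{q(\cdot)}(L^{p(\cdot)})}(\{u_k\}/m)\le1\}$. Gradients: let $s\in\mathcal{P}_b(X)$ and $u:X\to\overline{\mathbb{R}}$ be measurable and finite a.e. A sequence $\{g_k\}_{k\in\mathbb{Z}}$ of non-negative measurable functions is a vector $s(\cdot)$-gradient of $u$ (written $\{g_k\}\in\mathbb{D}^{s(\cdot)}(u)$) if there is a $\mu$-null set $N_u$ such that $|u(x)-u(y)|\le d(x,y)^{s(x)}g_k(x)+d(x,y)^{s(y)}g_k(y)$ for all $k\in\mathbb{Z}$ and all $x,y\in X\setminus N_u$ with $2^{-k-1}\le d(x,y)<2^{-k}$. Function spaces: $\|u\|_{\dot M^{s(\cdot)}_{p(\cdot),q(\cdot)}}=\inf_{g\in\mathbb{D}^{s(\cdot)}(u)}\|g\|_{L^{p(\cdot)}(\ell^{q(\cdot)})}$ and $\|u\|_{\dot N^{s(\cdot)}_{p(\cdot),q(\cdot)}}=\inf_{g\in\mathbb{D}^{s(\cdot)}(u)}\|g\|_{\ell^{q(\cdot)}(L^{p(\cdot)})}$. For $A\in\{M,N\}$, $A^{s(\cdot)}_{p(\cdot),q(\cdot)}(X,d,\mu)$ is the space of $u\in L^{p(\cdot)}(X,\mu)$ with $\|u\|_{\dot A^{s(\cdot)}_{p(\cdot),q(\cdot)}}<\infty$, with quasi-norm $\|u\|_{L^{p(\cdot)}}+\|u\|_{\dot A^{s(\cdot)}_{p(\cdot),q(\cdot)}}$.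 $Y\hookrightarrow\hookrightarrow Z$ (compact embedding) means $Y\subseteq Z$ with continuous inclusion mapping bounded subsets of $Y$ to totally bounded subsets of $Z$. *)

theory Defs
  imports "HOL-Analysis.Analysis" "HOL-Probability.Essential_Supremum"
begin

definition metric_measure_space :: "'a::metric_space measure \<Rightarrow> bool" where
  "metric_measure_space M \<longleftrightarrow> sets M = sets borel \<and>
     (\<forall>x r. 0 < r \<longrightarrow> 0 < emeasure M (ball x r) \<and> emeasure M (ball x r) < \<infinity>)"


section \<open>Exponents\<close>

definition essinf :: "'a measure \<Rightarrow> ('a \<Rightarrow> ennreal) \<Rightarrow> ennreal" where
  "essinf M f = Sup {z. AE x in M. z \<le> f x}"

definition exponents :: "'a measure \<Rightarrow> ('a \<Rightarrow> ennreal) set" where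
  "exponents M = {p \<in> borel_measurable M. (\<forall>x\<in>space M. 0 < p x) \<and> 0 < essinf M p}"

definition bdd_exponents :: "'a measure \<Rightarrow> ('a \<Rightarrow> ennreal) set" where
  "bdd_exponents M = {p \<in> exponents M. esssup M p < \<infinity>}"


section \<open>Variable exponent Lebesgue spaces and mixed sequence spaces\<close>

text \<open>
  Power of an extended non-negative number, meant for exponents \<open>b > 0\<close>.
  Bounded exponents may still be infinite on a null set; there
  \<open>enn2real \<infinity> = 0\<close> is used as exponent, which has no effect on any notion below.
\<close>

definition enn_powr :: "ennreal \<Rightarrow> real \<Rightarrow> ennreal" where
  "enn_powr a b = (if a = \<infinity> then \<infinity> else ennreal (enn2real a powr b))"

text \<open>
  Modulars and quasi-norms only depend on absolute values, so they are defined for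
  \<open>[0, \<infinity>]\<close>-valued functions. A quasi-norm is \<open>\<infinity>\<close> when the set of admissible \<open>c\<close> is empty.
\<close>

definition Lp_modular :: "'a measure \<Rightarrow> ('a \<Rightarrow> ennreal) \<Rightarrow> ('a \<Rightarrow> ennreal) \<Rightarrow> ennreal" where
  "Lp_modular M p f = (\<integral>\<^sup>+x. enn_powr (f x) (enn2real (p x)) \<partial>M)"

definition Lp_qnorm :: "'a measure \<Rightarrow> ('a \<Rightarrow> ennreal) \<Rightarrow> ('a \<Rightarrow> ennreal) \<Rightarrow> ennreal" where
  "Lp_qnorm M p f = Inf {ennreal c |c. 0 < c \<and> Lp_modular M p (\<lambda>x. f x / ennreal c) \<le> 1}"

definition eabs :: "('a \<Rightarrow> ereal) \<Rightarrow> 'a \<Rightarrow> ennreal" where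
  "eabs u = (\<lambda>x. e2ennreal \<bar>u x\<bar>)"

text \<open>
  Functions are not identified when they agree almost everywhere. For a bounded exponent \<open>p\<close>,
  members of \<open>Lp_space M p\<close> are automatically finite almost everywhere.
\<close>

definition Lp_space :: "'a measure \<Rightarrow> ('a \<Rightarrow> ennreal) \<Rightarrow> ('a \<Rightarrow> ereal) set" where
  "Lp_space M p = {u \<in> borel_measurable M.
     \<exists>c>0. Lp_modular M p (\<lambda>x. ennreal c * eabs u x) < \<infinity>}"

definition lq_qnorm :: "ennreal \<Rightarrow> (int \<Rightarrow> ennreal) \<Rightarrow> ennreal" where
  "lq_qnorm q a = (if q = \<infinity> then (SUP k. a k)
     else enn_powr (\<Sum>\<^sub>\<infinity>k. enn_powr (a k) (enn2real q)) (1 / enn2real q))"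

definition Lp_lq_qnorm ::
  "'a measure \<Rightarrow> ('a \<Rightarrow> ennreal) \<Rightarrow> ('a \<Rightarrow> ennreal) \<Rightarrow> (int \<Rightarrow> 'a \<Rightarrow> ennreal) \<Rightarrow> ennreal" where
  "Lp_lq_qnorm M p q f = Lp_qnorm M p (\<lambda>x. lq_qnorm (q x) (\<lambda>k. f k x))"

text \<open>In \<open>ennreal\<close> we have \<open>1 / \<infinity> = 0\<close>, so that \<open>c powr enn2real (1 / \<infinity>) = 1\<close> for \<open>c > 0\<close>.\<close>

definition lq_Lp_modular ::
  "'a measure \<Rightarrow> ('a \<Rightarrow> ennreal) \<Rightarrow> ('a \<Rightarrow> ennreal) \<Rightarrow> (int \<Rightarrow> 'a \<Rightarrow> ennreal) \<Rightarrow> ennreal" where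
  "lq_Lp_modular M p q f = (\<Sum>\<^sub>\<infinity>k. Inf {ennreal c |c. 0 < c \<and>
     Lp_modular M p (\<lambda>x. f k x / ennreal (c powr enn2real (1 / q x))) \<le> 1})"

definition lq_Lp_qnorm ::
  "'a measure \<Rightarrow> ('a \<Rightarrow> ennreal) \<Rightarrow> ('a \<Rightarrow> ennreal) \<Rightarrow> (int \<Rightarrow> 'a \<Rightarrow> ennreal) \<Rightarrow> ennreal" where
  "lq_Lp_qnorm M p q f =
     Inf {ennreal m |m. 0 < m \<and> lq_Lp_modular M p q (\<lambda>k x. f k x / ennreal m) \<le> 1}"


section \<open>Vector gradients and the spaces M and N\<close>

definition vec_gradients ::
  "'a::metric_space measure \<Rightarrow> ('a \<Rightarrow> ennreal) \<Rightarrow> ('a \<Rightarrow> ereal) \<Rightarrow> (int \<Rightarrow> 'a \<Rightarrow> ennreal) set" where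
  "vec_gradients M s u = {g. (\<forall>k. g k \<in> borel_measurable M) \<and>
     (\<exists>N\<in>null_sets M. \<forall>k. \<forall>x\<in>space M - N. \<forall>y\<in>space M - N.
        2 powi (- k - 1) \<le> dist x y \<and> dist x y < 2 powi (- k) \<longrightarrow>
        e2ennreal \<bar>u x - u y\<bar> \<le> ennreal (dist x y powr enn2real (s x)) * g k x
                             + ennreal (dist x y powr enn2real (s y)) * g k y)}"

definition M_seminorm :: "'a::metric_space measure \<Rightarrow> ('a \<Rightarrow> ennreal) \<Rightarrow> ('a \<Rightarrow> ennreal) \<Rightarrow>
    ('a \<Rightarrow> ennreal) \<Rightarrow> ('a \<Rightarrow> ereal) \<Rightarrow> ennreal" where
  "M_seminorm M s p q u = (INF g\<in>vec_gradients M s u. Lp_lq_qnorm M p q g)"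

definition N_seminorm :: "'a::metric_space measure \<Rightarrow> ('a \<Rightarrow> ennreal) \<Rightarrow> ('a \<Rightarrow> ennreal) \<Rightarrow>
    ('a \<Rightarrow> ennreal) \<Rightarrow> ('a \<Rightarrow> ereal) \<Rightarrow> ennreal" where
  "N_seminorm M s p q u = (INF g\<in>vec_gradients M s u. lq_Lp_qnorm M p q g)"

definition M_space :: "'a::metric_space measure \<Rightarrow> ('a \<Rightarrow> ennreal) \<Rightarrow> ('a \<Rightarrow> ennreal) \<Rightarrow>
    ('a \<Rightarrow> ennreal) \<Rightarrow> ('a \<Rightarrow> ereal) set" where
  "M_space M s p q = {u \<in> Lp_space M p. M_seminorm M s p q u < \<infinity>}"

definition N_space :: "'a::metric_space measure \<Rightarrow> ('a \<Rightarrow> ennreal) \<Rightarrow> ('a \<Rightarrow> ennreal) \<Rightarrow>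
    ('a \<Rightarrow> ennreal) \<Rightarrow> ('a \<Rightarrow> ereal) set" where
  "N_space M s p q = {u \<in> Lp_space M p. N_seminorm M s p q u < \<infinity>}"

definition Lp_norm :: "'a measure \<Rightarrow> ('a \<Rightarrow> ennreal) \<Rightarrow> ('a \<Rightarrow> ereal) \<Rightarrow> ennreal" where
  "Lp_norm M p u = Lp_qnorm M p (eabs u)"

definition M_norm :: "'a::metric_space measure \<Rightarrow> ('a \<Rightarrow> ennreal) \<Rightarrow> ('a \<Rightarrow> ennreal) \<Rightarrow>
    ('a \<Rightarrow> ennreal) \<Rightarrow> ('a \<Rightarrow> ereal) \<Rightarrow> ennreal" where
  "M_norm M s p q u = Lp_norm M p u + M_seminorm M s p q u"

definition N_norm :: "'a::metric_space measure \<Rightarrow> ('a \<Rightarrow> ennreal) \<Rightarrow> ('a \<Rightarrow> ennreal) \<Rightarrow>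
    ('a \<Rightarrow> ennreal) \<Rightarrow> ('a \<Rightarrow> ereal) \<Rightarrow> ennreal" where
  "N_norm M s p q u = Lp_norm M p u + N_seminorm M s p q u"


section \<open>Compact embeddings\<close>

text \<open>
  For spaces \<open>Y\<close> and \<open>Z\<close> of a.e. finite functions with quasi-norms \<open>nY\<close> and \<open>nZ\<close>.
  Differences are taken pointwise in \<open>ereal\<close>; the values where \<open>\<infinity>\<close> is subtracted from \<open>\<infinity>\<close>
  only concern null sets.
\<close>

definition continuously_embedded :: "('a \<Rightarrow> ereal) set \<Rightarrow> (('a \<Rightarrow> ereal) \<Rightarrow> ennreal) \<Rightarrow>
    ('a \<Rightarrow> ereal) set \<Rightarrow> (('a \<Rightarrow> ereal) \<Rightarrow> ennreal) \<Rightarrow> bool" where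
  "continuously_embedded Y nY Z nZ \<longleftrightarrow> Y \<subseteq> Z \<and>
     (\<forall>u\<in>Y. \<forall>\<epsilon>>0. \<exists>\<delta>>0. \<forall>v\<in>Y. nY (\<lambda>x. v x - u x) < ennreal \<delta> \<longrightarrow> nZ (\<lambda>x. v x - u x) < ennreal \<epsilon>)"

definition qnorm_bounded :: "(('a \<Rightarrow> ereal) \<Rightarrow> ennreal) \<Rightarrow> ('a \<Rightarrow> ereal) set \<Rightarrow> bool" where
  "qnorm_bounded nY S \<longleftrightarrow> (\<exists>C::real. \<forall>u\<in>S. nY u \<le> ennreal C)"

definition qnorm_totally_bounded ::
  "('a \<Rightarrow> ereal) set \<Rightarrow> (('a \<Rightarrow> ereal) \<Rightarrow> ennreal) \<Rightarrow> ('a \<Rightarrow> ereal) set \<Rightarrow> bool" where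
  "qnorm_totally_bounded Z nZ S \<longleftrightarrow>
     (\<forall>\<epsilon>>0. \<exists>K. finite K \<and> K \<subseteq> Z \<and> (\<forall>u\<in>S. \<exists>v\<in>K. nZ (\<lambda>x. u x - v x) < ennreal \<epsilon>))"

definition compactly_embedded :: "('a \<Rightarrow> ereal) set \<Rightarrow> (('a \<Rightarrow> ereal) \<Rightarrow> ennreal) \<Rightarrow>
    ('a \<Rightarrow> ereal) set \<Rightarrow> (('a \<Rightarrow> ereal) \<Rightarrow> ennreal) \<Rightarrow> bool" where
  "compactly_embedded Y nY Z nZ \<longleftrightarrow> continuously_embedded Y nY Z nZ \<and>
     (\<forall>S\<subseteq>Y. qnorm_bounded nY S \<longrightarrow> qnorm_totally_bounded Z nZ S)"

end

theory Submission
  imports Defs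
begin

text \<open>
  Infinite measure destroys compactness because bump functions can escape to infinity; finite
  measure, together with the lower bound \<open>h\<close>, makes the space totally bounded, and then a
  Kolmogorov-Riesz argument applies.

  \<^emph>\<open>Finite measure implies compactness.\<close> Disjoint balls of radius \<open>r/2\<close> each carry mass at least
  \<open>h(r/2)\<close>, so finite measure allows only finitely many of them and \<open>X\<close> is covered by finitely many
  \<open>r\<close>-balls for each \<open>r\<close> in \<open>(0,1]\<close>. Bounds on the \<open>M\<close> or \<open>N\<close> norm of \<open>u\<close> bound the modulars of all
  members \<open>g k\<close> of some vector gradient, uniformly in \<open>k\<close>. The tail
  \<open>F = sup\<^sub>j\<^sub>\<ge>\<^sub>n 2 powr (- j s0) * g j\<close>, with \<open>s0 > 0\<close> a lower bound of \<open>s\<close>, satisfies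
  \<open>|u x - u y| \<le> F x + F y\<close> whenever \<open>d(x,y) < 2 powr (-n)\<close>, and its modular is dominated by a
  geometric tail, hence tends to \<open>0\<close> uniformly on bounded sets (\<open>gradient_tail_modular_small\<close>,
  \<open>gradient_tail_oscillation_bound\<close>). The heart of the matter is the criterion
  \<open>totally_bounded_if_small_oscillation\<close>: a set that is bounded in modular and has uniformly small
  oscillation in this sense is totally bounded in \<open>L\<^sup>p\<close>. As \<open>p\<close> is merely measurable, replacing
  \<open>u\<close> on a small cell by its value at a typical point \<open>y\<close> of the cell is not enough: there
  \<open>F(y) powr p(y)\<close> is bounded only in terms of the measure of the cell, which gives no good bound of
  \<open>F(y) powr p(x)\<close> at the other points. Two scales are used instead. A coarse one gives
  \<open>|u| \<le> F + K\<close> with a small \<open>F\<close> and a constant \<open>K\<close>, which makes the family equi-integrable; a fine one, with oscillation bound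
  \<open>F'\<close>, approximates \<open>u\<close> by one of finitely many step functions wherever \<open>F'\<close> is small at some point of the
  cell. On the remaining cells \<open>F' \<ge> \<delta>\<close>, so that the constant \<open>K\<close> is absorbed into \<open>(K/\<delta>) F'\<close>.

  \<^emph>\<open>Compactness implies finite measure.\<close> Unit balls have uniformly bounded measure, so infinite measure
  yields arbitrarily large \<open>1\<close>-separated sets. The bumps of radius \<open>1/2\<close> around their points are
  bounded in \<open>M\<close> and \<open>N\<close>: with \<open>\<sigma> \<le> s \<le> 1 - \<sigma>\<close>, the constant multiples
  \<open>2 * 2 powr (- \<sigma> |k|)\<close> of the indicator of the ball form a gradient, and these coefficients are
  either summable to any positive power (\<open>\<sigma> > 0\<close>, when \<open>s\<^sup>+ < 1\<close>) or bounded, which suffices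
  for \<open>q = \<infinity>\<close>. On the other hand the bumps are uniformly separated in \<open>L\<^sup>\<beta>\<close>, because the
  balls of radius \<open>1/4\<close> have measure at least \<open>h(1/4)\<close>, so no finite net can serve them all.
\<close>

section \<open>Powers of extended non-negative numbers\<close>

lemma ennreal_pos_real_lower_bound:
  assumes "0 < (z::ennreal)"
  obtains a where "0 < a" "ennreal a \<le> z"
  using assms by (cases z) (auto intro: that[of 1])

lemma enn_powr_top [simp]: "enn_powr \<infinity> e = \<infinity>" "enn_powr top e = top"
  by (simp_all add: enn_powr_def)

lemma enn_powr_ennreal: "0 \<le> t \<Longrightarrow> enn_powr (ennreal t) e = ennreal (t powr e)"
  by (simp add: enn_powr_def)

lemma enn_powr_0 [simp]: "enn_powr 0 e = 0"
  by (simp add: enn_powr_def)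

lemma enn_powr_mono:
  assumes "a \<le> b" "0 \<le> e"
  shows "enn_powr a e \<le> enn_powr b e"
  using assms
  by (cases a; cases b) (auto simp: enn_powr_def top_unique intro!: ennreal_leI powr_mono2)

lemma enn_powr_powr:
  assumes "e \<noteq> 0"
  shows "enn_powr (enn_powr a e) (1 / e) = a"
  using assms by (cases a) (auto simp: enn_powr_def powr_powr)

lemma enn_powr_powr':
  assumes "e \<noteq> 0"
  shows "enn_powr (enn_powr a (1 / e)) e = a"
  using assms by (cases a) (auto simp: enn_powr_def powr_powr)

lemma enn_powr_cmult:
  assumes "0 < t"
  shows "enn_powr (ennreal t * a) e = ennreal (t powr e) * enn_powr a e"
  using assms
  by (cases a) (auto simp: enn_powr_def ennreal_mult_top enn2real_mult powr_mult
      ennreal_mult'[symmetric] ennreal_mult_eq_top_iff)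

lemma enn_powr_add_le:
  assumes "0 \<le> e"
  shows "enn_powr (a + b) e \<le> ennreal (2 powr e) * (enn_powr a e + enn_powr b e)"
proof -
  have "a + b \<le> ennreal 2 * max a b"
    by (simp add: mult_2 add_mono)
  hence "enn_powr (a + b) e \<le> ennreal (2 powr e) * enn_powr (max a b) e"
    using enn_powr_mono[OF _ assms] enn_powr_cmult[of 2 "max a b" e] by fastforce
  also have "enn_powr (max a b) e \<le> enn_powr a e + enn_powr b e"
    by (cases "a \<le> b") (auto simp: max_def add_increasing add_increasing2)
  finally show ?thesis by (simp add: mult_left_mono)
qed

text \<open>
  Taking the inverse power turns the bound \<open>T\<close> of the powers into a bound of the \<open>f j\<close>, hence of their
  supremum, so that monotonicity of powers suffices and continuity does not enter.
\<close>
lemma enn_powr_SUP_le: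
  assumes "0 < e" and "\<And>j. j \<in> I \<Longrightarrow> enn_powr (f j) e \<le> T"
  shows "enn_powr (SUP j\<in>I. f j) e \<le> T"
proof -
  have "f j \<le> enn_powr T (1 / e)" if "j \<in> I" for j
    using enn_powr_mono[OF assms(2)[OF that], of "1 / e"] assms(1) by (simp add: enn_powr_powr)
  hence "(SUP j\<in>I. f j) \<le> enn_powr T (1 / e)"
    by (rule SUP_least)
  from enn_powr_mono[OF this, of e] show ?thesis
    using assms(1) by (simp add: enn_powr_powr')
qed

lemma enn_powr_le_one: "a \<le> 1 \<Longrightarrow> 0 \<le> e \<Longrightarrow> enn_powr a e \<le> 1"
  using enn_powr_mono[of a 1 e] enn_powr_ennreal[of 1 e] by simp

lemma measurable_enn_powr [measurable]:
  assumes [measurable]: "f \<in> borel_measurable M" "e \<in> borel_measurable M"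
  shows "(\<lambda>x. enn_powr (f x) (e x)) \<in> borel_measurable M"
  unfolding enn_powr_def by measurable

lemma divide_ennreal_ennreal:
  assumes "0 < c"
  shows "a / ennreal c = ennreal (1 / c) * a"
  by (simp add: assms divide_ennreal_def inverse_ennreal mult.commute inverse_eq_divide)

section \<open>Modulars and quasi-norms for bounded exponents\<close>

lemma Lp_modular_mono:
  assumes "AE x in M. f x \<le> g x"
  shows "Lp_modular M p f \<le> Lp_modular M p g"
  unfolding Lp_modular_def using assms
  by (intro nn_integral_mono_AE) (auto elim!: eventually_mono intro: enn_powr_mono)

lemma Lp_modular_divide_le_1:
  assumes "Lp_qnorm M p f < ennreal c"
  shows "Lp_modular M p (\<lambda>x. f x / ennreal c) \<le> 1"
proof -
  obtain d where d: "0 < d" "ennreal d < ennreal c" "Lp_modular M p (\<lambda>x. f x / ennreal d) \<le> 1"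
    using assms unfolding Lp_qnorm_def Inf_less_iff by auto
  have "Lp_modular M p (\<lambda>x. f x / ennreal c) \<le> Lp_modular M p (\<lambda>x. f x / ennreal d)"
    using d by (intro Lp_modular_mono AE_I2)
      (auto simp: divide_ennreal_ennreal ennreal_less_iff intro!: mult_right_mono ennreal_leI divide_left_mono)
  thus ?thesis using d(3) by simp
qed

lemma Lp_qnorm_le:
  "0 < c \<Longrightarrow> Lp_modular M p (\<lambda>x. f x / ennreal c) \<le> 1 \<Longrightarrow> Lp_qnorm M p f \<le> ennreal c"
  unfolding Lp_qnorm_def by (rule Inf_lower) auto

lemma Lp_qnorm_mono:
  assumes "AE x in M. f x \<le> g x"
  shows "Lp_qnorm M p f \<le> Lp_qnorm M p g"
proof -
  have "Lp_modular M p (\<lambda>x. f x / ennreal c) \<le> Lp_modular M p (\<lambda>x. g x / ennreal c)" for c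
    using assms by (intro Lp_modular_mono) (auto elim!: eventually_mono intro: divide_right_mono_ennreal)
  thus ?thesis unfolding Lp_qnorm_def
    by (intro Inf_superset_mono) (auto intro: order_trans)
qed

text \<open>
  The form in which exponents are used: real bounds that hold almost everywhere, so that a bounded
  exponent may still be infinite on a null set. The constants in the estimates depend on \<open>p\<close> only through \<open>lo\<close> and \<open>hi\<close>.
\<close>
locale bounded_exponent =
  fixes M :: "'a measure" and p :: "'a \<Rightarrow> ennreal" and lo hi :: real
  assumes exponent_measurable [measurable]: "p \<in> borel_measurable M"
    and lo_pos: "0 < lo" and lo_le_hi: "lo \<le> hi"
    and bounds: "AE x in M. lo \<le> enn2real (p x) \<and> enn2real (p x) \<le> hi"
begin

lemma hi_pos: "0 < hi"
  using lo_pos lo_le_hi by simp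

text \<open>
  Scaling by \<open>t\<close> costs \<open>t powr p(x)\<close>, which lies between \<open>t powr lo\<close> and \<open>t powr hi\<close> in one order or
  the other; hence the common upper bound \<open>T\<close>.
\<close>
lemma Lp_modular_cmult_le:
  assumes [measurable]: "f \<in> borel_measurable M" and "0 < t"
    and T: "t powr lo \<le> T" "t powr hi \<le> T"
  shows "Lp_modular M p (\<lambda>x. ennreal t * f x) \<le> ennreal T * Lp_modular M p f"
proof -
  have le: "t powr e \<le> T" if "lo \<le> e" "e \<le> hi" for e
  proof (cases "1 \<le> t")
    case True
    thus ?thesis using powr_mono[OF that(2) True] T by simp
  next
    case False
    thus ?thesis using powr_mono'[OF that(1), of t] T \<open>0 < t\<close> by simp
  qed
  have "AE x in M. enn_powr (ennreal t * f x) (enn2real (p x)) \<le> ennreal T * enn_powr (f x) (enn2real (p x))"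
    using bounds
    by eventually_elim (use \<open>0 < t\<close> le in \<open>auto simp: enn_powr_cmult intro!: mult_right_mono ennreal_leI\<close>)
  hence "Lp_modular M p (\<lambda>x. ennreal t * f x) \<le> (\<integral>\<^sup>+x. ennreal T * enn_powr (f x) (enn2real (p x)) \<partial>M)"
    unfolding Lp_modular_def by (rule nn_integral_mono_AE)
  thus ?thesis by (simp add: Lp_modular_def nn_integral_cmult)
qed

lemma Lp_modular_cmult_le_small:
  assumes "f \<in> borel_measurable M" "0 < t" "t \<le> 1"
  shows "Lp_modular M p (\<lambda>x. ennreal t * f x) \<le> ennreal (t powr lo) * Lp_modular M p f"
  using assms lo_le_hi by (intro Lp_modular_cmult_le) (auto intro: powr_mono')

lemma Lp_modular_cmult_le_large:
  assumes "f \<in> borel_measurable M" "1 \<le> t"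
  shows "Lp_modular M p (\<lambda>x. ennreal t * f x) \<le> ennreal (t powr hi) * Lp_modular M p f"
  using assms lo_le_hi by (intro Lp_modular_cmult_le) (auto intro: powr_mono)

text \<open>
  The modular is subadditive up to the constant \<open>2 powr hi\<close>, which replaces convexity for exponents below \<open>1\<close>.
\<close>
lemma Lp_modular_add_le:
  assumes [measurable]: "f \<in> borel_measurable M" "g \<in> borel_measurable M"
  shows "Lp_modular M p (\<lambda>x. f x + g x) \<le> ennreal (2 powr hi) * (Lp_modular M p f + Lp_modular M p g)"
proof -
  have "AE x in M. enn_powr (f x + g x) (enn2real (p x))
      \<le> ennreal (2 powr hi) * (enn_powr (f x) (enn2real (p x)) + enn_powr (g x) (enn2real (p x)))"
    using bounds
  proof eventually_elim
    case (elim x)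
    show ?case
      by (rule order_trans[OF enn_powr_add_le]) (use elim in \<open>auto intro!: mult_right_mono ennreal_leI powr_mono\<close>)
  qed
  hence "Lp_modular M p (\<lambda>x. f x + g x) \<le>
      (\<integral>\<^sup>+x. ennreal (2 powr hi) * (enn_powr (f x) (enn2real (p x)) + enn_powr (g x) (enn2real (p x))) \<partial>M)"
    unfolding Lp_modular_def by (rule nn_integral_mono_AE)
  thus ?thesis by (simp add: Lp_modular_def nn_integral_cmult nn_integral_add)
qed

lemma Lp_modular_indicator_le:
  assumes "A \<in> sets M" "0 < t" "t \<le> 1"
  shows "Lp_modular M p (\<lambda>x. ennreal t * indicator A x) \<le> ennreal (t powr lo) * emeasure M A"
proof -
  have "Lp_modular M p (indicator A) \<le> (\<integral>\<^sup>+x. indicator A x \<partial>M)"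
    unfolding Lp_modular_def
    by (intro nn_integral_mono) (auto simp: indicator_def enn_powr_le_one)
  also have "\<dots> = emeasure M A" using assms(1) by simp
  finally show ?thesis
    using Lp_modular_cmult_le_small[of "indicator A" t] assms
    by (meson borel_measurable_indicator mult_left_mono order_trans zero_le)
qed

text \<open>
  Small modulars force small quasi-norms, with a threshold independent of the function. This allows
  approximation arguments to be run entirely on the modular, which is an integral.
\<close>
lemma Lp_qnorm_less_if_modular_small:
  assumes "0 < \<epsilon>"
  shows "\<exists>\<tau>>0. \<forall>f\<in>borel_measurable M. Lp_modular M p f \<le> ennreal \<tau> \<longrightarrow> Lp_qnorm M p f < ennreal \<epsilon>"
proof (intro exI conjI ballI impI)
  define c where "c = min 1 (\<epsilon> / 2)"
  have c: "0 < c" "c \<le> 1" "c < \<epsilon>" using assms by (auto simp: c_def min_def)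
  show "0 < c powr hi" using c by simp
  fix f assume f [measurable]: "f \<in> borel_measurable M" "Lp_modular M p f \<le> ennreal (c powr hi)"
  have "Lp_modular M p (\<lambda>x. f x / ennreal c) \<le> ennreal ((1 / c) powr hi) * Lp_modular M p f"
    unfolding divide_ennreal_ennreal[OF c(1)] using c by (intro Lp_modular_cmult_le_large) auto
  also have "\<dots> \<le> ennreal ((1 / c) powr hi) * ennreal (c powr hi)"
    by (intro mult_left_mono f) auto
  also have "\<dots> = 1"
    using c by (simp add: ennreal_mult'[symmetric] powr_mult[symmetric])
  finally have "Lp_qnorm M p f \<le> ennreal c" by (rule Lp_qnorm_le[OF c(1)])
  also have "\<dots> < ennreal \<epsilon>" using c by (simp add: ennreal_less_iff)
  finally show "Lp_qnorm M p f < ennreal \<epsilon>" .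
qed

end

lemma exponents_lower_bound:
  assumes "q \<in> exponents M"
  obtains a :: real where "0 < a" "AE x in M. ennreal a \<le> q x"
proof -
  have "0 < essinf M q" using assms by (simp add: exponents_def)
  then obtain z where z: "0 < z" "AE x in M. z \<le> q x"
    unfolding essinf_def less_Sup_iff by auto
  obtain a where a: "0 < a" "ennreal a \<le> z"
    using ennreal_pos_real_lower_bound[OF z(1)] .
  show ?thesis using z(2) by (intro that[OF a(1)]) (auto elim!: eventually_mono intro: order_trans[OF a(2)])
qed

lemma bdd_exponents_bounded_exponent:
  assumes "p \<in> bdd_exponents M"
  obtains lo hi where "bounded_exponent M p lo hi"
proof -
  have p: "p \<in> exponents M" "p \<in> borel_measurable M" "esssup M p < \<infinity>"
    using assms by (auto simp: bdd_exponents_def exponents_def)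
  obtain a where a: "0 < a" "AE x in M. ennreal a \<le> p x"
    using exponents_lower_bound[OF p(1)] .
  obtain b where b: "0 \<le> b" "esssup M p = ennreal b"
    using p(3) by (cases "esssup M p") auto
  have "AE x in M. p x \<le> ennreal b" using esssup_AE[of p M] b by simp
  with a(2) have "AE x in M. a \<le> enn2real (p x) \<and> enn2real (p x) \<le> max a b"
  proof eventually_elim
    case (elim x)
    thus ?case using a(1) b(1) by (cases "p x") (auto simp: top_unique)
  qed
  with a p(2) have "bounded_exponent M p a (max a b)" by unfold_locales auto
  thus ?thesis by (rule that)
qed

section \<open>Total boundedness of spaces of finite measure\<close>

lemma metric_measure_space_sets:
  assumes "metric_measure_space M"
  shows "sets M = sets borel" "space M = UNIV"
  using assms sets_eq_imp_space_eq[of M borel] by (auto simp: metric_measure_space_def)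

text \<open>
  If no finite set of centres covers, a separated set can always be extended by an uncovered point.
  Both directions of the equivalence rest on this dichotomy: finite measure excludes large separated
  sets, infinite measure excludes finite covers.
\<close>
lemma finite_cover_or_separated:
  fixes r :: real
  assumes "0 < r"
  shows "(\<exists>T::'a::metric_space set. finite T \<and> (\<forall>x. \<exists>t\<in>T. dist t x < r)) \<or>
    (\<forall>n. \<exists>A::'a set. finite A \<and> card A = n \<and> (\<forall>x\<in>A. \<forall>y\<in>A. x \<noteq> y \<longrightarrow> r \<le> dist x y))"
proof (rule disj_imp[THEN iffD2], rule impI)
  assume no_cover: "\<not> (\<exists>T::'a set. finite T \<and> (\<forall>x. \<exists>t\<in>T. dist t x < r))"
  show "\<forall>n. \<exists>A::'a set. finite A \<and> card A = n \<and> (\<forall>x\<in>A. \<forall>y\<in>A. x \<noteq> y \<longrightarrow> r \<le> dist x y)"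
  proof
    fix n
    show "\<exists>A::'a set. finite A \<and> card A = n \<and> (\<forall>x\<in>A. \<forall>y\<in>A. x \<noteq> y \<longrightarrow> r \<le> dist x y)"
    proof (induction n)
      case 0
      show ?case by (intro exI[of _ "{}"]) auto
    next
      case (Suc n)
      then obtain A :: "'a set" where A: "finite A" "card A = n"
        "\<forall>x\<in>A. \<forall>y\<in>A. x \<noteq> y \<longrightarrow> r \<le> dist x y" by blast
      then obtain x where x: "\<forall>t\<in>A. r \<le> dist t x" using no_cover by (meson not_le)
      hence "x \<notin> A" using assms by auto
      with A x show ?case
        by (intro exI[of _ "insert x A"]) (auto simp: dist_commute)
    qed
  qed
qed

lemma finite_cover_if_finite_measure:
  fixes M :: "'a::metric_space measure"
  assumes M: "metric_measure_space M" and fin: "emeasure M (space M) < \<infinity>"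
    and "0 < r" and h: "0 < (INF x. emeasure M (ball x (r / 2)))"
  obtains T :: "'a set" where "finite T" "\<And>x. \<exists>t\<in>T. dist t x < r"
proof -
  note sp = metric_measure_space_sets[OF M]
  obtain h0 where h0: "0 < h0" "ennreal h0 \<le> (INF x. emeasure M (ball x (r / 2)))"
    using ennreal_pos_real_lower_bound[OF h] .
  obtain m where m: "0 \<le> m" "emeasure M UNIV = ennreal m"
    using fin sp by (cases "emeasure M UNIV") auto
  obtain n :: nat where n: "m < real n * h0"
    using reals_Archimedean3[OF h0(1)] by blast
  have "\<not> (\<exists>A::'a set. finite A \<and> card A = n \<and> (\<forall>x\<in>A. \<forall>y\<in>A. x \<noteq> y \<longrightarrow> r \<le> dist x y))"
  proof
    assume "\<exists>A::'a set. finite A \<and> card A = n \<and> (\<forall>x\<in>A. \<forall>y\<in>A. x \<noteq> y \<longrightarrow> r \<le> dist x y)"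
    then obtain A :: "'a set" where A: "finite A" "card A = n"
      "\<forall>x\<in>A. \<forall>y\<in>A. x \<noteq> y \<longrightarrow> r \<le> dist x y" by blast
    have disj: "disjoint_family_on (\<lambda>x. ball x (r / 2)) A"
      unfolding disjoint_family_on_def
    proof (intro ballI impI)
      fix x y assume xy: "x \<in> A" "y \<in> A" "x \<noteq> y"
      hence "r \<le> dist x y" using A by blast
      hence "dist x z < r / 2 \<Longrightarrow> dist y z < r / 2 \<Longrightarrow> False" for z
        using dist_triangle[of x y z] by (simp add: dist_commute)
      thus "ball x (r / 2) \<inter> ball y (r / 2) = {}" by (auto simp: disjoint_iff)
    qed
    have "ennreal (real n * h0) = (\<Sum>x\<in>A. ennreal h0)"
      using h0 A by (simp add: ennreal_mult ennreal_of_nat_eq_real_of_nat)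
    also have "\<dots> \<le> (\<Sum>x\<in>A. emeasure M (ball x (r / 2)))"
      using h0(2) by (intro sum_mono) (auto simp: le_INF_iff)
    also have "\<dots> = emeasure M (\<Union>x\<in>A. ball x (r / 2))"
      using A(1) disj by (intro sum_emeasure) (auto simp: sp)
    also have "\<dots> \<le> ennreal m"
      unfolding m(2)[symmetric] by (intro emeasure_mono) (auto simp: sp)
    finally show False using n m by (simp add: ennreal_le_iff)
  qed
  thus ?thesis using finite_cover_or_separated[OF \<open>0 < r\<close>, where ?'a = 'a] that by blast
qed

text \<open>
  Numbering each point by the first ball that contains it partitions the space into finitely many
  measurable cells; two points of one cell share that ball, whence the factor \<open>2\<close>.
\<close>
lemma measurable_cell_index:
  fixes M :: "'a::metric_space measure"
  assumes M: "metric_measure_space M" and "finite T" and cover: "\<And>x::'a. \<exists>t\<in>T. dist t x < r"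
  obtains n :: nat and cell :: "'a \<Rightarrow> nat"
  where "cell \<in> measurable M (count_space UNIV)" "\<And>x. cell x < n"
    "\<And>x y. cell x = cell y \<Longrightarrow> dist x y < 2 * r"
proof -
  note sp = metric_measure_space_sets[OF M]
  obtain ts where ts: "set ts = T" using finite_list[OF \<open>finite T\<close>] by blast
  define P where "P = (\<lambda>x i. i < length ts \<and> x \<in> ball (ts ! i) r)"
  define cell where "cell = (\<lambda>x. LEAST i. P x i)"
  have [measurable]: "ball a r \<in> sets M" for a using sp by simp
  have "Measurable.pred M (\<lambda>x. P x i)" for i unfolding P_def by measurable
  hence meas: "cell \<in> measurable M (count_space UNIV)"
    unfolding cell_def by measurable
  have cell: "P x (cell x)" for x
  proof -
    obtain t where "t \<in> set ts" "dist t x < r" using cover ts by blast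
    then obtain i where "P x i" by (auto simp: P_def in_set_conv_nth)
    thus ?thesis unfolding cell_def by (rule LeastI)
  qed
  show ?thesis
  proof (rule that[OF meas])
    show "cell x < length ts" for x using cell by (auto simp: P_def)
    show "dist x y < 2 * r" if "cell x = cell y" for x y
      using cell[of x] cell[of y] that dist_triangle[of x y "ts ! cell x"]
      by (auto simp: P_def dist_commute)
  qed
qed

section \<open>A Kolmogorov-Riesz criterion for variable exponents\<close>

text \<open>
  A one-scale version of a gradient: up to a null set, \<open>F\<close> controls the differences of \<open>u\<close> over
  distances below \<open>r\<close>. Finiteness of \<open>u\<close> off the same null set makes differences meaningful.
\<close>
definition oscillation_bound ::
  "'a::metric_space measure \<Rightarrow> real \<Rightarrow> ('a \<Rightarrow> ereal) \<Rightarrow> ('a \<Rightarrow> ennreal) \<Rightarrow> bool" where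
  "oscillation_bound M r u F \<longleftrightarrow> F \<in> borel_measurable M \<and>
     (\<exists>N\<in>null_sets M. \<forall>x\<in>-N. \<bar>u x\<bar> \<noteq> \<infinity> \<and>
        (\<forall>y\<in>-N. dist x y < r \<longrightarrow> e2ennreal \<bar>u x - u y\<bar> \<le> F x + F y))"

lemma e2ennreal_triangle:
  fixes a b c :: ereal
  assumes "\<bar>a\<bar> \<noteq> \<infinity>" "\<bar>b\<bar> \<noteq> \<infinity>" "\<bar>c\<bar> \<noteq> \<infinity>"
  shows "e2ennreal \<bar>a - c\<bar> \<le> e2ennreal \<bar>a - b\<bar> + e2ennreal \<bar>b - c\<bar>"
  using assms by (cases a; cases b; cases c)
    (auto simp: e2ennreal_ereal ennreal_plus[symmetric] simp del: ennreal_plus intro!: ennreal_leI)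

lemma enn_powr_le_imp_le:
  assumes "enn_powr a e \<le> ennreal Q" "1 \<le> Q" "0 < lo" "lo \<le> e"
  shows "a \<le> ennreal (Q powr (1 / lo))"
proof -
  have "a = enn_powr (enn_powr a e) (1 / e)" using assms by (simp add: enn_powr_powr)
  also have "\<dots> \<le> enn_powr (ennreal Q) (1 / e)" using assms by (intro enn_powr_mono) auto
  also have "\<dots> = ennreal (Q powr (1 / e))" using assms by (simp add: enn_powr_ennreal)
  also have "\<dots> \<le> ennreal (Q powr (1 / lo))"
    using assms by (intro ennreal_leI powr_mono) (auto intro: divide_left_mono)
  finally show ?thesis .
qed

lemma borel_measurable_eabs [measurable]:
  "u \<in> borel_measurable M \<Longrightarrow> eabs u \<in> borel_measurable M"
  unfolding eabs_def by measurable

text \<open>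
  A function that is bounded in modular and oscillates by at most \<open>F\<close> at scale \<open>r\<close> is bounded by \<open>F\<close> plus
  a constant that depends on \<open>u\<close> and \<open>F\<close> only through the common bound \<open>R\<close> of their modulars. For given \<open>x\<close>, the mass \<open>h0\<close> of the ball around
  \<open>x\<close> provides a point \<open>y\<close> at which the integrands of both modulars are at most \<open>Q\<close>, so that \<open>|u|\<close> and \<open>F\<close>
  are at most \<open>k\<close> there, and \<open>|u x| \<le> |u x - u y| + |u y| \<le> F x + 2 k\<close>.
\<close>
lemma bounded_up_to_oscillation:
  fixes M :: "'a::metric_space measure"
  assumes M: "metric_measure_space M" and "bounded_exponent M p lo hi"
    and h: "0 < h0" "\<And>x. ennreal h0 \<le> emeasure M (ball x r)" and "0 \<le> R"
  obtains K where "0 < K"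
    "\<And>u F. \<lbrakk>u \<in> borel_measurable M; oscillation_bound M r u F; Lp_modular M p (eabs u) \<le> ennreal R;
       Lp_modular M p F \<le> ennreal R\<rbrakk> \<Longrightarrow> AE x in M. eabs u x \<le> F x + ennreal K"
proof -
  interpret bounded_exponent M p lo hi by fact
  note sp = metric_measure_space_sets[OF M]
  define Q where "Q = max 1 ((2 * R + 1) / h0)"
  define k where "k = Q powr (1 / lo)"
  have Q: "1 \<le> Q" and Qh: "2 * R < Q * h0"
    using h(1) by (auto simp: Q_def field_simps max_def split: if_splits)
  have k: "0 < k" using Q by (simp add: k_def)
  show ?thesis
  proof (rule that[of "k + k"])
    show "0 < k + k" using k by simp
    fix u F assume u [measurable]: "u \<in> borel_measurable M" and F: "oscillation_bound M r u F"
      and ru: "Lp_modular M p (eabs u) \<le> ennreal R" and rF: "Lp_modular M p F \<le> ennreal R"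
    have F_meas [measurable]: "F \<in> borel_measurable M" using F by (simp add: oscillation_bound_def)
    obtain N where N: "N \<in> null_sets M" "\<And>x. x \<notin> N \<Longrightarrow> \<bar>u x\<bar> \<noteq> \<infinity>"
      "\<And>x y. x \<notin> N \<Longrightarrow> y \<notin> N \<Longrightarrow> dist x y < r \<Longrightarrow> e2ennreal \<bar>u x - u y\<bar> \<le> F x + F y"
      using F unfolding oscillation_bound_def by auto
    have "eabs u x \<le> F x + ennreal (k + k)" if x: "x \<notin> N" for x
    proof -
      \<comment> \<open>Otherwise the sum of the two modulars would be at least \<open>Q * h0 > 2 * R\<close>.\<close>
      have "\<exists>y. dist x y < r \<and> y \<notin> N \<and> lo \<le> enn2real (p y) \<and>
          enn_powr (eabs u y) (enn2real (p y)) + enn_powr (F y) (enn2real (p y)) \<le> ennreal Q"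
      proof (rule ccontr)
        assume contra: "\<not> ?thesis"
        have [measurable]: "ball x r \<in> sets M" using sp by simp
        have "AE y in M. ennreal Q * indicator (ball x r) y \<le>
            enn_powr (eabs u y) (enn2real (p y)) + enn_powr (F y) (enn2real (p y))"
          using AE_not_in[OF N(1)] bounds
        proof eventually_elim
          case (elim y)
          thus ?case using contra by (auto simp: indicator_def not_le less_imp_le)
        qed
        hence "(\<integral>\<^sup>+y. ennreal Q * indicator (ball x r) y \<partial>M) \<le>
            (\<integral>\<^sup>+y. enn_powr (eabs u y) (enn2real (p y)) + enn_powr (F y) (enn2real (p y)) \<partial>M)"
          by (rule nn_integral_mono_AE)
        also have "\<dots> = Lp_modular M p (eabs u) + Lp_modular M p F"
          by (simp add: nn_integral_add Lp_modular_def)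
        also have "\<dots> \<le> ennreal (2 * R)"
          using add_mono[OF ru rF] \<open>0 \<le> R\<close> by (simp add: ennreal_plus[symmetric] del: ennreal_plus)
        finally have "ennreal Q * emeasure M (ball x r) \<le> ennreal (2 * R)"
          by (simp add: nn_integral_cmult)
        moreover have "ennreal (Q * h0) \<le> ennreal Q * emeasure M (ball x r)"
          using mult_left_mono[OF h(2)[of x], of "ennreal Q"] Q h(1) by (simp add: ennreal_mult)
        ultimately have "ennreal (Q * h0) \<le> ennreal (2 * R)" by (rule order_trans[rotated])
        thus False using Qh \<open>0 \<le> R\<close> Q h(1) by (simp add: ennreal_le_iff)
      qed
      then obtain y where y: "dist x y < r" "y \<notin> N" "lo \<le> enn2real (p y)"
        "enn_powr (eabs u y) (enn2real (p y)) + enn_powr (F y) (enn2real (p y)) \<le> ennreal Q" by blast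
      have uy: "eabs u y \<le> ennreal k" unfolding k_def
        by (rule enn_powr_le_imp_le[OF _ Q lo_pos y(3)])
           (use y(4) in \<open>meson add_increasing2 order_trans zero_le order_refl\<close>)
      have Fy: "F y \<le> ennreal k" unfolding k_def
        by (rule enn_powr_le_imp_le[OF _ Q lo_pos y(3)])
           (use y(4) in \<open>meson add_increasing order_trans zero_le order_refl\<close>)
      have "eabs u x \<le> e2ennreal \<bar>u x - u y\<bar> + eabs u y"
        using e2ennreal_triangle[of "u x" "u y" 0] N(2)[OF x] N(2)[OF y(2)] by (simp add: eabs_def)
      also have "\<dots> \<le> (F x + ennreal k) + ennreal k"
        using N(3)[OF x y(2,1)] Fy by (intro add_mono uy) (meson add_left_mono order_trans)
      also have "\<dots> = F x + ennreal (k + k)" using k by (simp only: ennreal_plus[OF less_imp_le less_imp_le] add.assoc)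
      finally show ?thesis .
    qed
    thus "AE x in M. eabs u x \<le> F x + ennreal (k + k)"
      using AE_not_in[OF N(1)] by (auto elim!: eventually_mono)
  qed
qed

lemma oscillation_bound_antimono:
  assumes "oscillation_bound M r u F" "r' \<le> r"
  shows "oscillation_bound M r' u F"
  using assms(1) less_le_trans[OF _ assms(2)] unfolding oscillation_bound_def
  by (elim conjE bexE, intro conjI bexI) auto

lemma step_functions_in_Lp_space:
  assumes fin: "emeasure M (space M) < \<infinity>" and [measurable]: "v \<in> borel_measurable M"
    and "0 < L" and le: "\<And>x. \<bar>v x\<bar> \<le> L"
  shows "(\<lambda>x. ereal (v x)) \<in> Lp_space M p"
proof -
  have "ennreal (1 / L) * ennreal \<bar>v x\<bar> \<le> 1" for x
    using le[of x] \<open>0 < L\<close> by (simp add: ennreal_mult'[symmetric])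
  hence "Lp_modular M p (\<lambda>x. ennreal (1 / L) * eabs (\<lambda>x. ereal (v x)) x) \<le> (\<integral>\<^sup>+x. 1 \<partial>M)"
    unfolding Lp_modular_def eabs_def by (intro nn_integral_mono enn_powr_le_one) (auto simp: e2ennreal_ereal)
  also have "\<dots> < \<infinity>" using fin by simp
  finally show ?thesis unfolding Lp_space_def using \<open>0 < L\<close>
    by (auto intro!: exI[of _ "1 / L"])
qed

text \<open>
  The key is the pointwise estimate \<open>|u - v| \<le> 2 \<delta> + F + (1 + K/\<delta>) F'\<close> between a member \<open>u\<close> of the
  set and a step function \<open>v\<close> from a finite net. Here \<open>F\<close> and \<open>F'\<close> bound the oscillation of \<open>u\<close> at a coarse
  and a fine scale, and \<open>|u| \<le> F + K\<close>. If a cell of the fine scale contains a point \<open>y\<close> with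
  \<open>F' y \<le> \<delta>\<close>, then \<open>v\<close> is the value \<open>u y\<close> rounded to the grid; otherwise \<open>v = 0\<close> and
  \<open>K \<le> (K/\<delta>) F'\<close> on the cell. The parameters are chosen in the order \<open>F\<close>, \<open>K\<close>, \<open>\<delta>\<close>, \<open>F'\<close>, each
  depending on the earlier ones.
\<close>
lemma totally_bounded_if_small_oscillation:
  fixes M :: "'a::metric_space measure"
  assumes M: "metric_measure_space M" and fin: "emeasure M (space M) < \<infinity>"
    and h: "\<forall>r. 0 < r \<and> r < 1 \<longrightarrow> 0 < (INF x. emeasure M (ball x r))"
    and exponent: "bounded_exponent M p lo hi"
    and S: "S \<subseteq> borel_measurable M"
    and R: "\<And>u. u \<in> S \<Longrightarrow> Lp_modular M p (eabs u) \<le> ennreal R"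
    and osc: "\<And>\<eta>. 0 < \<eta> \<Longrightarrow> \<exists>r>0. \<forall>u\<in>S. \<exists>F. oscillation_bound M r u F \<and> Lp_modular M p F \<le> ennreal \<eta>"
  shows "qnorm_totally_bounded (Lp_space M p) (Lp_norm M p) S"
  unfolding qnorm_totally_bounded_def
proof (intro allI impI)
  fix \<epsilon> :: real assume "0 < \<epsilon>"
  interpret bounded_exponent M p lo hi by fact
  note sp = metric_measure_space_sets[OF M]
  obtain m where m: "0 \<le> m" "emeasure M UNIV = ennreal m"
    using fin sp by (cases "emeasure M UNIV") auto
  obtain \<tau> where \<tau>: "0 < \<tau>"
    "\<And>f. f \<in> borel_measurable M \<Longrightarrow> Lp_modular M p f \<le> ennreal \<tau> \<Longrightarrow> Lp_qnorm M p f < ennreal \<epsilon>"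
    using Lp_qnorm_less_if_modular_small[OF \<open>0 < \<epsilon>\<close>] by blast
  \<comment> \<open>Every prescribed smallness of the oscillation is attained at a scale below \<open>1\<close>, and comes
    with a bound of the functions up to a constant.\<close>
  have scale: "\<exists>r K. 0 < r \<and> r < 1 \<and> 0 < K \<and> (\<forall>u\<in>S. \<exists>F. oscillation_bound M r u F \<and>
      Lp_modular M p F \<le> ennreal \<eta> \<and> (AE x in M. eabs u x \<le> F x + ennreal K))" if \<eta>_pos: "0 < \<eta>" for \<eta>
  proof -
    obtain r1 where r1: "0 < r1" "\<forall>u\<in>S. \<exists>F. oscillation_bound M r1 u F \<and> Lp_modular M p F \<le> ennreal \<eta>"
      using osc[OF \<eta>_pos] by blast
    define r where "r = min r1 (1 / 2)"
    have r: "0 < r" "r < 1" "r \<le> r1" using r1(1) by (auto simp: r_def)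
    obtain h0 where h0: "0 < h0" "ennreal h0 \<le> (INF x. emeasure M (ball x r))"
      using ennreal_pos_real_lower_bound h r by blast
    define R' where "R' = max 0 (max R \<eta>)"
    have R': "0 \<le> R'" "ennreal R \<le> ennreal R'" "ennreal \<eta> \<le> ennreal R'"
      by (auto simp: R'_def intro: ennreal_leI)
    obtain K where K: "0 < K"
      "\<And>u F. \<lbrakk>u \<in> borel_measurable M; oscillation_bound M r u F; Lp_modular M p (eabs u) \<le> ennreal R';
         Lp_modular M p F \<le> ennreal R'\<rbrakk> \<Longrightarrow> AE x in M. eabs u x \<le> F x + ennreal K"
      using bounded_up_to_oscillation[OF M exponent h0(1), of r R'] h0(2) R'(1) by (auto simp: le_INF_iff)
    have "\<exists>F. oscillation_bound M r u F \<and> Lp_modular M p F \<le> ennreal \<eta> \<and>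
        (AE x in M. eabs u x \<le> F x + ennreal K)" if u: "u \<in> S" for u
    proof -
      obtain F where F: "oscillation_bound M r u F" "Lp_modular M p F \<le> ennreal \<eta>"
        using r1(2) u oscillation_bound_antimono[OF _ r(3)] by blast
      have "AE x in M. eabs u x \<le> F x + ennreal K"
        using u S order_trans[OF R[OF u] R'(2)] order_trans[OF F(2) R'(3)] F(1) by (intro K(2)) blast+
      with F show ?thesis by blast
    qed
    with r K(1) show ?thesis by blast
  qed
  define c where "c = 2 powr hi"
  have c: "0 < c" by (simp add: c_def)
  \<comment> \<open>The three error terms receive \<open>\<tau>/3\<close> each; the powers of \<open>c\<close> come from two applications of
    quasi-subadditivity.\<close>
  define \<eta> where "\<eta> = \<tau> / (3 * c\<^sup>2)"
  have \<eta>: "0 < \<eta>" using \<tau> c by (simp add: \<eta>_def)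
  obtain r K where K: "0 < K" and coarse: "\<And>u. u \<in> S \<Longrightarrow> \<exists>F. oscillation_bound M r u F \<and>
      Lp_modular M p F \<le> ennreal \<eta> \<and> (AE x in M. eabs u x \<le> F x + ennreal K)"
    using scale[OF \<eta>] by blast
  define \<delta> where "\<delta> = min (1 / 2) ((\<tau> / (3 * c * (m + 1))) powr (1 / lo) / 2)"
  have \<delta>: "0 < \<delta>" "2 * \<delta> \<le> 1" and \<delta>_le: "2 * \<delta> \<le> (\<tau> / (3 * c * (m + 1))) powr (1 / lo)"
    using \<tau> c m by (auto simp: \<delta>_def)
  have \<delta>_small: "c * ((2 * \<delta>) powr lo * m) \<le> \<tau> / 3"
  proof -
    have "(2 * \<delta>) powr lo \<le> ((\<tau> / (3 * c * (m + 1))) powr (1 / lo)) powr lo"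
      using \<delta> \<delta>_le lo_pos by (intro powr_mono2) auto
    also have "\<dots> = \<tau> / (3 * c * (m + 1))" using \<tau> c m lo_pos by (simp add: powr_powr)
    finally have "(2 * \<delta>) powr lo * (3 * c * (m + 1)) \<le> \<tau>"
      using c m by (simp add: pos_le_divide_eq)
    moreover have "(2 * \<delta>) powr lo * (3 * c * m) \<le> (2 * \<delta>) powr lo * (3 * c * (m + 1))"
      using c by (intro mult_left_mono) auto
    ultimately show ?thesis by (simp add: mult_ac)
  qed
  define t where "t = 1 + K / \<delta>"
  have t: "1 \<le> t" using K \<delta> by (simp add: t_def)
  define \<eta>' where "\<eta>' = \<tau> / (3 * c\<^sup>2 * t powr hi)"
  have \<eta>': "0 < \<eta>'" using \<tau> c t by (simp add: \<eta>'_def)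
  obtain r' K' where r': "0 < r'" "r' < 1" and K': "0 < K'" and fine: "\<And>u. u \<in> S \<Longrightarrow> \<exists>F. oscillation_bound M r' u F \<and>
      Lp_modular M p F \<le> ennreal \<eta>' \<and> (AE x in M. eabs u x \<le> F x + ennreal K')"
    using scale[OF \<eta>'] by blast
  have "0 < (INF x. emeasure M (ball x (r' / 2 / 2)))" using h r' by simp
  then obtain T :: "'a set" where T: "finite T" "\<And>x. \<exists>t\<in>T. dist t x < r' / 2"
    using finite_cover_if_finite_measure[OF M fin, of "r' / 2"] r' by auto
  obtain n :: nat and cell :: "'a \<Rightarrow> nat" where
    cell_meas: "cell \<in> measurable M (count_space UNIV)" and cell_less: "\<And>x. cell x < n"
    and "\<And>x y. cell x = cell y \<Longrightarrow> dist x y < 2 * (r' / 2)"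
    by (rule measurable_cell_index[OF M T]) (rule that)
  hence cell_dist: "dist x y < r'" if "cell x = cell y" for x y using that by simp
  \<comment> \<open>On a good cell \<open>|u y| \<le> F' y + K' \<le> K' + 1\<close>, so this finite part of the grid suffices.\<close>
  define J :: int where "J = \<lceil>(K' + 1) / \<delta>\<rceil> + 1"
  define G where "G = (\<lambda>j::int. \<delta> * of_int j) ` {-J..J}"
  have finG: "finite G" by (simp add: G_def)
  have J: "0 \<le> J" using K' \<delta> by (simp add: J_def add_nonneg_nonneg ceiling_mono[of 0, simplified])
  have zeroG: "0 \<in> G" using J by (auto simp: G_def intro!: image_eqI[of _ _ 0])
  have G_le: "\<bar>a\<bar> \<le> \<delta> * of_int J" if "a \<in> G" for a
    using that \<delta> by (auto simp: G_def abs_mult simp flip: of_int_abs)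
  have round: "\<exists>a\<in>G. \<bar>w - a\<bar> \<le> \<delta>" if "\<bar>w\<bar> \<le> K' + 1" for w
  proof
    define j where "j = \<lfloor>w / \<delta>\<rfloor>"
    have j: "of_int j \<le> w / \<delta>" "w / \<delta> < of_int j + 1" by (auto simp: j_def)
    have "\<bar>w / \<delta>\<bar> \<le> (K' + 1) / \<delta>" using that \<delta> by (simp add: divide_right_mono)
    also have "\<dots> \<le> of_int (J - 1)" by (simp add: J_def)
    finally have "w / \<delta> \<le> of_int J - 1" "- (w / \<delta>) \<le> of_int J - 1"
      unfolding abs_le_iff by simp_all
    hence "of_int (- J) \<le> (of_int j :: real)" "of_int j \<le> (of_int J :: real)"
      using j unfolding of_int_minus by linarith+
    hence "j \<in> {-J..J}" unfolding of_int_le_iff by simp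
    thus "\<delta> * of_int j \<in> G" unfolding G_def by (rule imageI)
    show "\<bar>w - \<delta> * of_int j\<bar> \<le> \<delta>" using j \<delta> by (simp add: field_simps)
  qed
  define net where "net = (\<lambda>a x. ereal (a (cell x))) ` (PiE {..<n} (\<lambda>_. G))"
  have step_meas: "(\<lambda>x. a (cell x)) \<in> borel_measurable M" for a :: "nat \<Rightarrow> real"
    using cell_meas by (rule measurable_compose) simp
  show "\<exists>K. finite K \<and> K \<subseteq> Lp_space M p \<and> (\<forall>u\<in>S. \<exists>v\<in>K. Lp_norm M p (\<lambda>x. u x - v x) < ennreal \<epsilon>)"
  proof (intro exI[of _ net] conjI ballI)
    show "finite net" using finG by (auto simp: net_def intro!: finite_PiE)
    show "net \<subseteq> Lp_space M p"
    proof
      fix v assume "v \<in> net"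
      then obtain a where a: "a \<in> PiE {..<n} (\<lambda>_. G)" "v = (\<lambda>x. ereal (a (cell x)))" by (auto simp: net_def)
      have "\<bar>a (cell x)\<bar> \<le> \<delta> * of_int J + 1" for x
        using G_le[of "a (cell x)"] a(1) cell_less[of x] by (fastforce simp: PiE_iff)
      thus "v \<in> Lp_space M p" unfolding a(2) using J \<delta>
        by (intro step_functions_in_Lp_space[OF fin step_meas, of "\<delta> * of_int J + 1"]) (auto intro: add_nonneg_pos)
    qed
    fix u assume u: "u \<in> S"
    have u_meas [measurable]: "u \<in> borel_measurable M" using u S by auto
    obtain F where F: "oscillation_bound M r u F" "Lp_modular M p F \<le> ennreal \<eta>"
      "AE x in M. eabs u x \<le> F x + ennreal K" using coarse[OF u] by blast
    obtain F' where F': "oscillation_bound M r' u F'" "Lp_modular M p F' \<le> ennreal \<eta>'"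
      "AE x in M. eabs u x \<le> F' x + ennreal K'" using fine[OF u] by blast
    have [measurable]: "F \<in> borel_measurable M" "F' \<in> borel_measurable M"
      using F F' by (auto simp: oscillation_bound_def)
    obtain N0 where N0: "N0 \<in> null_sets M" "\<And>x. x \<notin> N0 \<Longrightarrow> \<bar>u x\<bar> \<noteq> \<infinity>"
      "\<And>x y. x \<notin> N0 \<Longrightarrow> y \<notin> N0 \<Longrightarrow> dist x y < r' \<Longrightarrow> e2ennreal \<bar>u x - u y\<bar> \<le> F' x + F' y"
      using F'(1) unfolding oscillation_bound_def by auto
    define A where "A = {x. x \<notin> N0 \<and> eabs u x \<le> F x + ennreal K \<and> eabs u x \<le> F' x + ennreal K'}"
    have AE_A: "AE x in M. x \<in> A"
      using AE_not_in[OF N0(1)] F(3) F'(3) by eventually_elim (simp add: A_def)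
    define w where "w = (\<lambda>x. real_of_ereal (u x))"
    have w: "u x = ereal (w x)" if "x \<in> A" for x
      using N0(2)[of x] that by (auto simp: A_def w_def ereal_real')
    \<comment> \<open>\<open>P i b\<close>: the value \<open>b\<close> is admissible on cell \<open>i\<close>, either as the default value on a bad cell or
      as the rounded value of \<open>u\<close> at a point where \<open>F'\<close> is small.\<close>
    define P where "P = (\<lambda>i b. (b = 0 \<and> (\<forall>x\<in>A. cell x = i \<longrightarrow> ennreal \<delta> \<le> F' x)) \<or>
        (\<exists>y\<in>A. cell y = i \<and> F' y \<le> ennreal \<delta> \<and> \<bar>w y - b\<bar> \<le> \<delta>))"
    have "\<exists>b\<in>G. P i b" for i
    proof (cases "\<exists>y\<in>A. cell y = i \<and> F' y \<le> ennreal \<delta>")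
      case True
      then obtain y where y: "y \<in> A" "cell y = i" "F' y \<le> ennreal \<delta>" by blast
      have "ennreal \<bar>w y\<bar> \<le> F' y + ennreal K'"
        using y(1) w[OF y(1)] by (auto simp: A_def eabs_def e2ennreal_ereal)
      also have "\<dots> \<le> ennreal \<delta> + ennreal K'" using y(3) by (intro add_right_mono)
      also have "\<dots> \<le> ennreal (K' + 1)"
        using \<delta> K' by (simp add: ennreal_plus[symmetric] del: ennreal_plus)
      finally have "\<bar>w y\<bar> \<le> K' + 1" using K' by (simp add: ennreal_le_iff del: ennreal_plus)
      then obtain b where "b \<in> G" "\<bar>w y - b\<bar> \<le> \<delta>" using round by blast
      thus ?thesis using y unfolding P_def by blast
    next
      case False
      hence "\<forall>x\<in>A. cell x = i \<longrightarrow> ennreal \<delta> \<le> F' x" by (auto simp: not_le intro: less_imp_le)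
      thus ?thesis using zeroG by (auto simp: P_def)
    qed
    then obtain a where a: "\<And>i. a i \<in> G" "\<And>i. P i (a i)" by metis
    define v where "v = (\<lambda>x. ereal (a (cell x)))"
    have "v = (\<lambda>x. ereal (restrict a {..<n} (cell x)))" using cell_less by (simp add: v_def)
    moreover have "restrict a {..<n} \<in> PiE {..<n} (\<lambda>_. G)" using a(1) by auto
    ultimately have v: "v \<in> net" unfolding net_def by blast
    have v_meas [measurable]: "v \<in> borel_measurable M" unfolding v_def using step_meas[of a] by simp
    have pointwise: "e2ennreal \<bar>u x - v x\<bar> \<le> ennreal (2 * \<delta>) + (F x + ennreal t * F' x)" if x: "x \<in> A" for x
      using a(2)[of "cell x"] unfolding P_def
    proof
      assume zero: "a (cell x) = 0 \<and> (\<forall>z\<in>A. cell z = cell x \<longrightarrow> ennreal \<delta> \<le> F' z)"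
      have "ennreal K = ennreal (K / \<delta>) * ennreal \<delta>" using K \<delta> by (simp add: ennreal_mult'[symmetric])
      also have "\<dots> \<le> ennreal t * F' x" using zero x \<delta> K
        by (intro mult_mono ennreal_leI) (auto simp: t_def)
      finally have "F x + ennreal K \<le> F x + ennreal t * F' x" by (rule add_left_mono)
      moreover have "e2ennreal \<bar>u x - v x\<bar> \<le> F x + ennreal K"
        using zero x by (simp add: v_def A_def eabs_def zero_ereal_def[symmetric])
      ultimately show ?thesis by (meson add_increasing order_trans zero_le)
    next
      assume "\<exists>y\<in>A. cell y = cell x \<and> F' y \<le> ennreal \<delta> \<and> \<bar>w y - a (cell x)\<bar> \<le> \<delta>"
      then obtain y where y: "y \<in> A" "cell y = cell x" "F' y \<le> ennreal \<delta>" "\<bar>w y - a (cell x)\<bar> \<le> \<delta>" by blast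
      have "e2ennreal \<bar>u x - v x\<bar> \<le> e2ennreal \<bar>u x - u y\<bar> + e2ennreal \<bar>u y - v x\<bar>"
        using w[OF x] w[OF y(1)] by (intro e2ennreal_triangle) (auto simp: v_def)
      also have "\<dots> \<le> (F' x + ennreal \<delta>) + ennreal \<delta>"
      proof (rule add_mono)
        have "e2ennreal \<bar>u x - u y\<bar> \<le> F' x + F' y"
          using x y cell_dist[of x y] by (intro N0(3)) (auto simp: A_def)
        also have "\<dots> \<le> F' x + ennreal \<delta>" by (intro add_left_mono y)
        finally show "e2ennreal \<bar>u x - u y\<bar> \<le> F' x + ennreal \<delta>" .
        show "e2ennreal \<bar>u y - v x\<bar> \<le> ennreal \<delta>"
          using y(4) w[OF y(1)] by (simp add: v_def e2ennreal_ereal ennreal_leI)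
      qed
      also have "\<dots> = ennreal (2 * \<delta>) + F' x" using \<delta>
        by (simp add: add.assoc add.commute[of _ "F' x"] ennreal_plus[symmetric] del: ennreal_plus)
      also have "\<dots> \<le> ennreal (2 * \<delta>) + (F x + ennreal t * F' x)"
        using mult_right_mono[OF ennreal_leI[OF t], of "F' x"]
        by (intro add_left_mono add_increasing) auto
      finally show ?thesis .
    qed
    have "Lp_modular M p (eabs (\<lambda>x. u x - v x)) \<le>
        Lp_modular M p (\<lambda>x. ennreal (2 * \<delta>) * indicator UNIV x + (F x + ennreal t * F' x))"
      using AE_A by (intro Lp_modular_mono) (auto elim!: eventually_mono simp: eabs_def pointwise)
    also have "\<dots> \<le> ennreal c * (Lp_modular M p (\<lambda>x. ennreal (2 * \<delta>) * indicator UNIV x) +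
        Lp_modular M p (\<lambda>x. F x + ennreal t * F' x))"
      unfolding c_def by (intro Lp_modular_add_le) simp_all
    also have "\<dots> \<le> ennreal c * (ennreal ((2 * \<delta>) powr lo) * ennreal m +
        ennreal c * (ennreal \<eta> + ennreal (t powr hi) * ennreal \<eta>'))"
    proof (intro mult_left_mono add_mono)
      show "Lp_modular M p (\<lambda>x. ennreal (2 * \<delta>) * indicator UNIV x) \<le> ennreal ((2 * \<delta>) powr lo) * ennreal m"
        using Lp_modular_indicator_le[of UNIV "2 * \<delta>"] \<delta> sp m by simp
      have "Lp_modular M p (\<lambda>x. F x + ennreal t * F' x) \<le>
          ennreal c * (Lp_modular M p F + Lp_modular M p (\<lambda>x. ennreal t * F' x))"
        unfolding c_def by (intro Lp_modular_add_le) simp_all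
      also have "\<dots> \<le> ennreal c * (ennreal \<eta> + ennreal (t powr hi) * ennreal \<eta>')"
      proof (intro mult_left_mono add_mono F(2))
        show "Lp_modular M p (\<lambda>x. ennreal t * F' x) \<le> ennreal (t powr hi) * ennreal \<eta>'"
          using Lp_modular_cmult_le_large[of F' t] t F'(2) by (meson \<open>F' \<in> borel_measurable M\<close> mult_left_mono order_trans zero_le)
      qed simp
      finally show "Lp_modular M p (\<lambda>x. F x + ennreal t * F' x) \<le>
        ennreal c * (ennreal \<eta> + ennreal (t powr hi) * ennreal \<eta>')" .
    qed simp_all
    also have "\<dots> = ennreal (c * ((2 * \<delta>) powr lo * m + c * (\<eta> + t powr hi * \<eta>')))"
      using c \<delta> m \<eta> \<eta>' by (simp add: ennreal_mult[symmetric] ennreal_plus[symmetric] del: ennreal_plus)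
    also have "\<dots> \<le> ennreal \<tau>"
    proof (rule ennreal_leI)
      have "c * (c * \<eta>) = \<tau> / 3" using c by (simp add: \<eta>_def power2_eq_square)
      moreover have "c * (c * (t powr hi * \<eta>')) = \<tau> / 3" using c t by (simp add: \<eta>'_def power2_eq_square)
      ultimately show "c * ((2 * \<delta>) powr lo * m + c * (\<eta> + t powr hi * \<eta>')) \<le> \<tau>"
        using \<delta>_small by (simp add: distrib_left)
    qed
    finally have "Lp_norm M p (\<lambda>x. u x - v x) < ennreal \<epsilon>"
      unfolding Lp_norm_def by (intro \<tau>(2)) simp_all
    with v show "\<exists>v\<in>net. Lp_norm M p (\<lambda>x. u x - v x) < ennreal \<epsilon>" by blast
  qed
qed

section \<open>Vector gradients bound the oscillation\<close>

lemma (in bounded_exponent) Lp_modular_le_powr: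
  assumes [measurable]: "f \<in> borel_measurable M" and "1 \<le> D"
    and le: "Lp_modular M p (\<lambda>x. f x / ennreal D) \<le> 1"
  shows "Lp_modular M p f \<le> ennreal (D powr hi)"
proof -
  have "ennreal D * (f x / ennreal D) = f x" for x
    using \<open>1 \<le> D\<close> by (simp add: divide_ennreal_ennreal mult.assoc[symmetric] ennreal_mult'[symmetric])
  hence "Lp_modular M p f = Lp_modular M p (\<lambda>x. ennreal D * (f x / ennreal D))" by simp
  also have "\<dots> \<le> ennreal (D powr hi) * Lp_modular M p (\<lambda>x. f x / ennreal D)"
    using \<open>1 \<le> D\<close> by (intro Lp_modular_cmult_le_large) auto
  also have "\<dots> \<le> ennreal (D powr hi) * 1" by (intro mult_left_mono le) simp
  finally show ?thesis by simp
qed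

lemma divide_divide_ennreal:
  assumes "0 < b" "0 < c"
  shows "a / ennreal b / ennreal c = a / ennreal (b * c)"
proof -
  have "ennreal (1 / (b * c)) = ennreal (1 / c) * ennreal (1 / b)"
    using assms by (simp add: ennreal_mult[symmetric] mult.commute)
  thus ?thesis using assms by (simp add: divide_ennreal_ennreal mult.assoc)
qed

lemma infsum_ennreal_ge_term:
  fixes f :: "'b \<Rightarrow> ennreal"
  shows "f k \<le> (\<Sum>\<^sub>\<infinity>k. f k)"
proof -
  have "infsum f {k} \<le> infsum f UNIV"
    by (rule infsum_mono_neutral) (auto intro: nonneg_summable_on_complete)
  thus ?thesis by simp
qed

lemma lq_qnorm_ge_term:
  assumes "0 < q"
  shows "a k \<le> lq_qnorm q a"
proof (cases "q = \<infinity>")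
  case True
  thus ?thesis by (simp add: lq_qnorm_def SUP_upper)
next
  case False
  hence e: "enn2real q > 0" using assms by (simp add: enn2real_positive_iff less_top)
  have "a k = enn_powr (enn_powr (a k) (enn2real q)) (1 / enn2real q)"
    using e by (simp add: enn_powr_powr)
  also have "\<dots> \<le> enn_powr (\<Sum>\<^sub>\<infinity>k. enn_powr (a k) (enn2real q)) (1 / enn2real q)"
    using e by (intro enn_powr_mono infsum_ennreal_ge_term) auto
  finally show ?thesis using False by (simp add: lq_qnorm_def)
qed

lemma Lp_lq_qnorm_controls_terms:
  assumes "q \<in> exponents M" "Lp_lq_qnorm M p q g < ennreal D"
  shows "Lp_modular M p (\<lambda>x. g k x / ennreal D) \<le> 1"
proof (rule Lp_modular_divide_le_1)
  have "Lp_qnorm M p (g k) \<le> Lp_lq_qnorm M p q g"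
    unfolding Lp_lq_qnorm_def using assms(1)
    by (intro Lp_qnorm_mono AE_I2) (auto simp: exponents_def intro: lq_qnorm_ge_term)
  thus "Lp_qnorm M p (g k) < ennreal D" using assms(2) by (rule order.strict_trans1)
qed

text \<open>
  Each summand of the mixed modular is at most \<open>1\<close>, so some \<open>c < 2\<close> is admissible in the infimum that
  defines it, and \<open>c powr (1/q)\<close> is then at most \<open>B = 2 powr (1/q0)\<close>, where \<open>q0 > 0\<close> is a lower bound of \<open>q\<close>.
\<close>
lemma lq_Lp_qnorm_controls_terms:
  assumes "q \<in> exponents M"
  obtains B where "1 \<le> B"
    "\<And>p g D k. lq_Lp_qnorm M p q g < ennreal D \<Longrightarrow> Lp_modular M p (\<lambda>x. g k x / ennreal (D * B)) \<le> 1"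
proof -
  obtain q0 where q0: "0 < q0" "AE x in M. ennreal q0 \<le> q x"
    using exponents_lower_bound[OF assms] .
  define B where "B = 2 powr (1 / q0)"
  have B: "1 \<le> B" using q0 by (simp add: B_def ge_one_powr_ge_zero)
  show ?thesis
  proof (rule that[OF B])
    fix p g D k assume "lq_Lp_qnorm M p q g < ennreal D"
    then obtain m where m: "0 < m" "ennreal m < ennreal D"
      "lq_Lp_modular M p q (\<lambda>k x. g k x / ennreal m) \<le> 1"
      unfolding lq_Lp_qnorm_def Inf_less_iff by auto
    have mD: "m \<le> D" using m by (simp add: ennreal_less_iff)
    have "Inf {ennreal c |c. 0 < c \<and>
        Lp_modular M p (\<lambda>x. (g k x / ennreal m) / ennreal (c powr enn2real (1 / q x))) \<le> 1} \<le> 1"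
      using m(3) unfolding lq_Lp_modular_def by (rule order_trans[OF infsum_ennreal_ge_term])
    hence "Inf {ennreal c |c. 0 < c \<and>
        Lp_modular M p (\<lambda>x. (g k x / ennreal m) / ennreal (c powr enn2real (1 / q x))) \<le> 1} < ennreal 2"
      by (rule order.strict_trans1) simp
    then obtain c where c: "0 < c" "c < 2"
      "Lp_modular M p (\<lambda>x. (g k x / ennreal m) / ennreal (c powr enn2real (1 / q x))) \<le> 1"
      unfolding Inf_less_iff by (auto simp: ennreal_less_iff)
    have "Lp_modular M p (\<lambda>x. g k x / ennreal (D * B)) \<le>
        Lp_modular M p (\<lambda>x. (g k x / ennreal m) / ennreal (c powr enn2real (1 / q x)))"
    proof (rule Lp_modular_mono)
      show "AE x in M. g k x / ennreal (D * B) \<le> (g k x / ennreal m) / ennreal (c powr enn2real (1 / q x))"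
        using q0(2)
      proof eventually_elim
        case (elim x)
        have "1 / q x \<le> 1 / ennreal q0"
          using elim q0(1)
          by (cases "q x") (auto simp: divide_ennreal_def top_unique inverse_ennreal intro!: ennreal_leI le_imp_inverse_le)
        also have "\<dots> = ennreal (1 / q0)"
          using q0(1) by (simp add: divide_ennreal_def inverse_ennreal inverse_eq_divide)
        finally have "enn2real (1 / q x) \<le> 1 / q0"
          using q0(1) enn2real_mono[of "1 / q x" "ennreal (1 / q0)"] by simp
        hence "2 powr enn2real (1 / q x) \<le> B" unfolding B_def by (intro powr_mono) auto
        moreover have "c powr enn2real (1 / q x) \<le> 2 powr enn2real (1 / q x)"
          using c by (intro powr_mono2) auto
        ultimately have "m * (c powr enn2real (1 / q x)) \<le> D * B"
          using mD m(1) by (intro mult_mono) auto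
        hence "1 / (D * B) \<le> 1 / (m * (c powr enn2real (1 / q x)))"
          using m(1) c(1) B mD by (intro divide_left_mono) auto
        hence "ennreal (1 / (D * B)) * g k x \<le> ennreal (1 / (m * (c powr enn2real (1 / q x)))) * g k x"
          by (intro mult_right_mono ennreal_leI) auto
        also have "\<dots> = g k x / ennreal (m * (c powr enn2real (1 / q x)))"
          using m(1) c(1) by (simp add: divide_ennreal_ennreal)
        also have "\<dots> = (g k x / ennreal m) / ennreal (c powr enn2real (1 / q x))"
          using m(1) c(1) by (simp add: divide_divide_ennreal)
        finally show ?case using m(1) mD B by (simp add: divide_ennreal_ennreal)
      qed
    qed
    thus "Lp_modular M p (\<lambda>x. g k x / ennreal (D * B)) \<le> 1" using c(3) by (rule order_trans)
  qed
qed

text \<open>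
  Every positive distance belongs to one of the annuli that index vector gradients.
\<close>
lemma dyadic_scale:
  fixes d :: real
  assumes "0 < d"
  obtains k :: int where "2 powi (- k - 1) \<le> d" "d < 2 powi (- k)"
proof
  define j where "j = \<lfloor>log 2 d\<rfloor>"
  have pow: "2 powi i = 2 powr (of_int i :: real)" for i by (simp add: powr_real_of_int')
  have "2 powr of_int j \<le> d" "d < 2 powr (of_int j + 1)"
    using assms by (simp_all add: j_def floor_correct flip: le_log_iff log_less_iff)
  thus "2 powi (- (- j - 1) - 1) \<le> d" "d < 2 powi (- (- j - 1))"
    unfolding pow by (simp_all add: add.commute)
qed

text \<open>
  The weights turn the scale-wise condition defining a vector gradient into a bound valid at all scales
  below \<open>2 powr (-n)\<close> at once. The supremum, rather than the sum, is dominated after taking powers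
  by the sum of the powers, whatever the exponent.
\<close>
definition gradient_tail :: "real \<Rightarrow> (int \<Rightarrow> 'a \<Rightarrow> ennreal) \<Rightarrow> nat \<Rightarrow> 'a \<Rightarrow> ennreal" where
  "gradient_tail s g n x = (SUP j. ennreal (2 powr (- (s * real (n + j)))) * g (int (n + j)) x)"

lemma gradient_tail_measurable [measurable]:
  "(\<And>k. g k \<in> borel_measurable M) \<Longrightarrow> gradient_tail s g n \<in> borel_measurable M"
  unfolding gradient_tail_def by measurable

text \<open>
  The \<open>j\<close>-th term has modular at most \<open>R * \<theta> ^ j\<close> with \<open>\<theta> = 2 powr (- s * lo) < 1\<close>, so the modular of
  the tail is at most \<open>R * \<theta> ^ n / (1 - \<theta>)\<close>.
\<close>
lemma gradient_tail_modular_small: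
  assumes "bounded_exponent M p lo hi" and "0 < s" "0 \<le> R" "0 < \<eta>"
  shows "\<exists>n. \<forall>g. (\<forall>k. g k \<in> borel_measurable M \<and> Lp_modular M p (g k) \<le> ennreal R) \<longrightarrow>
    Lp_modular M p (gradient_tail s g n) \<le> ennreal \<eta>"
proof -
  interpret bounded_exponent M p lo hi by fact
  define \<theta> where "\<theta> = 2 powr (- (s * lo))"
  have \<theta>: "0 < \<theta>" "\<theta> < 1"
    using \<open>0 < s\<close> lo_pos by (auto simp: \<theta>_def intro: powr_less_one)
  obtain n where "\<theta> ^ n < \<eta> * (1 - \<theta>) / (R + 1)"
    using real_arch_pow_inv[of "\<eta> * (1 - \<theta>) / (R + 1)" \<theta>] \<theta> \<open>0 \<le> R\<close> \<open>0 < \<eta>\<close> by auto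
  hence n: "\<theta> ^ n * (R + 1) < \<eta> * (1 - \<theta>)" using \<open>0 \<le> R\<close> by (simp add: pos_less_divide_eq)
  have "\<theta> ^ n * R \<le> \<theta> ^ n * (R + 1)" using \<theta> by (intro mult_left_mono) auto
  hence n': "\<theta> ^ n * R / (1 - \<theta>) \<le> \<eta>" using n \<theta> by (subst pos_divide_le_eq) linarith+
  have "Lp_modular M p (gradient_tail s g n) \<le> ennreal \<eta>"
    if g: "\<And>k. g k \<in> borel_measurable M" "\<And>k. Lp_modular M p (g k) \<le> ennreal R" for g
  proof -
    have [measurable]: "g k \<in> borel_measurable M" for k by (rule g)
    define f where "f = (\<lambda>j x. ennreal (2 powr (- (s * real (n + j)))) * g (int (n + j)) x)"
    have [measurable]: "f j \<in> borel_measurable M" for j unfolding f_def by measurable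
    have "AE x in M. enn_powr (gradient_tail s g n x) (enn2real (p x)) \<le> (\<Sum>j. enn_powr (f j x) (enn2real (p x)))"
      using bounds
    proof eventually_elim
      case (elim x)
      have "gradient_tail s g n x = (SUP j. f j x)" by (simp add: gradient_tail_def f_def)
      moreover have "enn_powr (f j x) (enn2real (p x)) \<le> (\<Sum>j. enn_powr (f j x) (enn2real (p x)))" for j
        using sum_le_suminf[of "\<lambda>j. enn_powr (f j x) (enn2real (p x))" "{j}"] by simp
      ultimately show ?case using elim lo_pos by (simp add: enn_powr_SUP_le)
    qed
    hence "Lp_modular M p (gradient_tail s g n) \<le> (\<integral>\<^sup>+x. (\<Sum>j. enn_powr (f j x) (enn2real (p x))) \<partial>M)"
      unfolding Lp_modular_def by (rule nn_integral_mono_AE)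
    also have "\<dots> = (\<Sum>j. Lp_modular M p (f j))"
      unfolding Lp_modular_def by (rule nn_integral_suminf) measurable
    also have "\<dots> \<le> (\<Sum>j. ennreal (\<theta> ^ n * R * \<theta> ^ j))"
    proof (rule suminf_le)
      fix j
      have "Lp_modular M p (f j) \<le> ennreal ((2 powr (- (s * real (n + j)))) powr lo) * Lp_modular M p (g (int (n + j)))"
        unfolding f_def using \<open>0 < s\<close> powr_mono[of "- (s * real (n + j))" 0 2]
        by (intro Lp_modular_cmult_le_small) auto
      also have "\<dots> \<le> ennreal ((2 powr (- (s * real (n + j)))) powr lo) * ennreal R"
        by (intro mult_left_mono g) auto
      also have "(2 powr (- (s * real (n + j)))) powr lo = \<theta> ^ (n + j)"
        by (simp add: \<theta>_def powr_powr mult_ac flip: powr_realpow)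
      finally show "Lp_modular M p (f j) \<le> ennreal (\<theta> ^ n * R * \<theta> ^ j)"
        using \<theta> \<open>0 \<le> R\<close> by (simp add: ennreal_mult'[symmetric] power_add mult_ac)
    qed auto
    also have "\<dots> = ennreal (\<Sum>j. \<theta> ^ n * R * \<theta> ^ j)"
      using \<theta> \<open>0 \<le> R\<close> by (intro suminf_ennreal2) (auto intro!: summable_mult summable_geometric)
    also have "(\<Sum>j. \<theta> ^ n * R * \<theta> ^ j) = \<theta> ^ n * R / (1 - \<theta>)"
      using \<theta> by (subst suminf_mult) (auto intro: summable_geometric simp: suminf_geometric)
    also have "ennreal \<dots> \<le> ennreal \<eta>" using n' by (rule ennreal_leI)
    finally show ?thesis .
  qed
  thus ?thesis by blast
qed

text \<open>
  A distance below \<open>2 powr (-n) \<le> 1\<close> lies in an annulus of index \<open>k \<ge> n\<close>, where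
  \<open>d powr s(z) \<le> 2 powr (- s0 * k)\<close> is exactly the weight in the tail.
\<close>
lemma gradient_tail_oscillation_bound:
  fixes M :: "'a::metric_space measure"
  assumes M: "metric_measure_space M" and s: "bounded_exponent M s s0 s1"
    and g: "g \<in> vec_gradients M s u" and finite: "AE x in M. \<bar>u x\<bar> \<noteq> \<infinity>"
  shows "oscillation_bound M (2 powr (- real n)) u (gradient_tail s0 g n)"
proof -
  interpret s: bounded_exponent M s s0 s1 by fact
  note sp = metric_measure_space_sets[OF M]
  have [measurable]: "g k \<in> borel_measurable M" for k using g by (auto simp: vec_gradients_def)
  obtain N1 where N1: "N1 \<in> null_sets M" "\<And>k x y. x \<notin> N1 \<Longrightarrow> y \<notin> N1 \<Longrightarrow>
      2 powi (- k - 1) \<le> dist x y \<Longrightarrow> dist x y < 2 powi (- k) \<Longrightarrow>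
      e2ennreal \<bar>u x - u y\<bar> \<le> ennreal (dist x y powr enn2real (s x)) * g k x
        + ennreal (dist x y powr enn2real (s y)) * g k y"
    using g sp by (auto simp: vec_gradients_def)
  have "AE x in M. \<bar>u x\<bar> \<noteq> \<infinity> \<and> s0 \<le> enn2real (s x)"
    using finite s.bounds by eventually_elim auto
  then obtain N2 where N2: "N2 \<in> null_sets M" "{x \<in> space M. \<not> (\<bar>u x\<bar> \<noteq> \<infinity> \<and> s0 \<le> enn2real (s x))} \<subseteq> N2"
    unfolding eventually_ae_filter by blast
  have N2': "\<bar>u x\<bar> \<noteq> \<infinity>" "s0 \<le> enn2real (s x)" if "x \<notin> N2" for x
    using subsetD[OF N2(2), of x] that sp by simp_all metis+
  show ?thesis unfolding oscillation_bound_def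
  proof (intro conjI bexI[of _ "N1 \<union> N2"] ballI impI)
    fix x assume x: "x \<in> - (N1 \<union> N2)"
    show "\<bar>u x\<bar> \<noteq> \<infinity>" using x by (intro N2') auto
    fix y assume y: "y \<in> - (N1 \<union> N2)" and dist: "dist x y < 2 powr (- real n)"
    show "e2ennreal \<bar>u x - u y\<bar> \<le> gradient_tail s0 g n x + gradient_tail s0 g n y"
    proof (cases "x = y")
      case True
      moreover have "u x - u x = 0" using \<open>\<bar>u x\<bar> \<noteq> \<infinity>\<close> by (cases "u x") auto
      ultimately show ?thesis by (simp add: e2ennreal_neg)
    next
      case False
      hence "0 < dist x y" by simp
      then obtain k :: int where k: "2 powi (- k - 1) \<le> dist x y" "dist x y < 2 powi (- k)"
        by (rule dyadic_scale)
      have "2 powr (real_of_int (- k - 1)) = 2 powi (- k - 1)" by (rule powr_real_of_int') auto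
      also note k(1)
      also note dist
      finally have "2 powr (real_of_int (- k - 1)) < 2 powr (- real n)" .
      from powr_less_cancel[OF this] have "- k - 1 < - int n" by linarith
      hence "k = int (n + nat (k - int n))" by simp
      then obtain j where j: "k = int (n + j)" by blast
      have term_le: "ennreal (dist x y powr enn2real (s z)) * g k z \<le> gradient_tail s0 g n z"
        if z: "z \<notin> N2" for z
      proof -
        have sz: "s0 \<le> enn2real (s z)" using z by (rule N2')
        have d: "dist x y \<le> 2 powr (- real (n + j))"
          using k(2) unfolding j by (simp add: powr_real_of_int'[symmetric] del: of_nat_add)
        have "dist x y powr enn2real (s z) \<le> dist x y powr s0"
          using order_trans[OF d, of 1] powr_mono[of "- real (n + j)" 0 2] by (intro powr_mono' sz) auto
        also have "\<dots> \<le> (2 powr (- real (n + j))) powr s0"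
          using d s.lo_pos by (intro powr_mono2) auto
        also have "\<dots> = 2 powr (- (s0 * real (n + j)))"
          by (simp add: powr_powr mult.commute del: of_nat_add)
        finally have "ennreal (dist x y powr enn2real (s z)) * g k z \<le>
            ennreal (2 powr (- (s0 * real (n + j)))) * g (int (n + j)) z"
          unfolding j by (intro mult_right_mono ennreal_leI) auto
        also have "\<dots> \<le> gradient_tail s0 g n z"
          unfolding gradient_tail_def by (rule SUP_upper) simp
        finally show ?thesis .
      qed
      have "e2ennreal \<bar>u x - u y\<bar> \<le> ennreal (dist x y powr enn2real (s x)) * g k x
          + ennreal (dist x y powr enn2real (s y)) * g k y"
        using x y k by (intro N1(2)) auto
      also have "\<dots> \<le> gradient_tail s0 g n x + gradient_tail s0 g n y"
        using x y by (intro add_mono term_le) auto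
      finally show ?thesis .
    qed
  qed (use N1 N2 in auto)
qed

lemma AE_finite_if_modular_finite:
  assumes "bounded_exponent M p lo hi" and [measurable]: "u \<in> borel_measurable M"
    and "Lp_modular M p (eabs u) < \<infinity>"
  shows "AE x in M. \<bar>u x\<bar> \<noteq> \<infinity>"
proof -
  interpret bounded_exponent M p lo hi by fact
  have "AE x in M. enn_powr (eabs u x) (enn2real (p x)) \<noteq> \<infinity>"
    using assms(3) unfolding Lp_modular_def by (intro nn_integral_PInf_AE) auto
  thus ?thesis by (auto elim!: eventually_mono simp: eabs_def)
qed

section \<open>Compact embeddings for finite measure\<close>

lemma totally_bounded_if_gradients_bounded:
  fixes M :: "'a::metric_space measure"
  assumes M: "metric_measure_space M" and fin: "emeasure M (space M) < \<infinity>"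
    and h: "\<forall>r. 0 < r \<and> r < 1 \<longrightarrow> 0 < (INF x. emeasure M (ball x r))"
    and p: "bounded_exponent M p lo hi" and s: "bounded_exponent M s s0 s1"
    and S: "S \<subseteq> borel_measurable M" and "0 \<le> R"
    and R: "\<And>u. u \<in> S \<Longrightarrow> Lp_modular M p (eabs u) \<le> ennreal R"
    and grad: "\<And>u. u \<in> S \<Longrightarrow> \<exists>g\<in>vec_gradients M s u. \<forall>k. Lp_modular M p (g k) \<le> ennreal R"
  shows "qnorm_totally_bounded (Lp_space M p) (Lp_norm M p) S"
proof (rule totally_bounded_if_small_oscillation[OF M fin h p S R])
  fix \<eta> :: real assume "0 < \<eta>"
  have "0 < s0" using s by (simp add: bounded_exponent_def)
  then obtain n where n: "\<And>g. (\<forall>k. g k \<in> borel_measurable M \<and> Lp_modular M p (g k) \<le> ennreal R) \<Longrightarrow>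
      Lp_modular M p (gradient_tail s0 g n) \<le> ennreal \<eta>"
    using gradient_tail_modular_small[OF p _ \<open>0 \<le> R\<close> \<open>0 < \<eta>\<close>] by blast
  have "\<exists>F. oscillation_bound M (2 powr - real n) u F \<and> Lp_modular M p F \<le> ennreal \<eta>" if u: "u \<in> S" for u
  proof -
    obtain g where g: "g \<in> vec_gradients M s u" "\<And>k. Lp_modular M p (g k) \<le> ennreal R"
      using grad[OF u] by blast
    have "AE x in M. \<bar>u x\<bar> \<noteq> \<infinity>"
      using S u order.strict_trans1[OF R[OF u], of \<infinity>] by (intro AE_finite_if_modular_finite[OF p]) auto
    hence "oscillation_bound M (2 powr - real n) u (gradient_tail s0 g n)"
      by (rule gradient_tail_oscillation_bound[OF M s g(1)])
    moreover have "Lp_modular M p (gradient_tail s0 g n) \<le> ennreal \<eta>"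
      using g by (intro n) (auto simp: vec_gradients_def)
    ultimately show ?thesis by blast
  qed
  thus "\<exists>r>0. \<forall>u\<in>S. \<exists>F. oscillation_bound M r u F \<and> Lp_modular M p F \<le> ennreal \<eta>"
    by (intro exI[of _ "2 powr - real n"]) auto
qed

text \<open>
  The embeddings of \<open>M\<close> and \<open>N\<close> spaces share one proof: all that enters about the seminorm is that
  it controls the modulars of the single members of some gradient, up to a constant factor \<open>B\<close>.
\<close>
lemma compactly_embedded_if_gradients_controlled:
  fixes M :: "'a::metric_space measure"
  assumes M: "metric_measure_space M" and fin: "emeasure M (space M) < \<infinity>"
    and h: "\<forall>r. 0 < r \<and> r < 1 \<longrightarrow> 0 < (INF x. emeasure M (ball x r))"
    and p: "p \<in> bdd_exponents M" and s: "s \<in> bdd_exponents M"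
    and Y: "Y \<subseteq> Lp_space M p" and nY: "\<And>u. nY u = Lp_norm M p u + sem u" and "1 \<le> B"
    and sem: "\<And>u D. sem u < ennreal D \<Longrightarrow>
      \<exists>g\<in>vec_gradients M s u. \<forall>k. Lp_modular M p (\<lambda>x. g k x / ennreal (D * B)) \<le> 1"
  shows "compactly_embedded Y nY (Lp_space M p) (Lp_norm M p)"
  unfolding compactly_embedded_def
proof (intro conjI allI impI)
  show "continuously_embedded Y nY (Lp_space M p) (Lp_norm M p)"
    unfolding continuously_embedded_def
  proof (intro conjI ballI allI impI Y)
    fix u and \<epsilon> :: real assume "u \<in> Y" "0 < \<epsilon>"
    thus "\<exists>\<delta>>0. \<forall>v\<in>Y. nY (\<lambda>x. v x - u x) < ennreal \<delta> \<longrightarrow> Lp_norm M p (\<lambda>x. v x - u x) < ennreal \<epsilon>"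
      unfolding nY by (intro exI[of _ \<epsilon>]) (auto intro: order.strict_trans1[rotated] simp: add_increasing2)
  qed
  fix S assume S: "S \<subseteq> Y" and "qnorm_bounded nY S"
  then obtain C :: real where C: "\<And>u. u \<in> S \<Longrightarrow> nY u \<le> ennreal C" unfolding qnorm_bounded_def by blast
  define D where "D = max 0 C + 1"
  have D: "1 \<le> D" by (simp add: D_def)
  have "ennreal C < ennreal D" unfolding D_def by (rule ennreal_lessI) auto
  hence less: "Lp_norm M p u < ennreal D" "sem u < ennreal D" if "u \<in> S" for u
    using C[OF that] unfolding nY
    by (meson add_increasing add_increasing2 order.strict_trans1 order_refl order_trans zero_le)+
  have DB: "1 \<le> D * B" "D \<le> D * B" using D \<open>1 \<le> B\<close> mult_mono[of 1 D 1 B] by auto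
  obtain lo hi where p': "bounded_exponent M p lo hi" using bdd_exponents_bounded_exponent[OF p] .
  obtain s0 s1 where s': "bounded_exponent M s s0 s1" using bdd_exponents_bounded_exponent[OF s] .
  interpret bounded_exponent M p lo hi by fact
  show "qnorm_totally_bounded (Lp_space M p) (Lp_norm M p) S"
  proof (rule totally_bounded_if_gradients_bounded[OF M fin h p' s'])
    show S': "S \<subseteq> borel_measurable M" using S Y by (auto simp: Lp_space_def)
    show "0 \<le> (D * B) powr hi" by simp
    fix u assume u: "u \<in> S"
    have "Lp_modular M p (eabs u) \<le> ennreal (D powr hi)"
      using u S' less(1)[OF u] D unfolding Lp_norm_def
      by (intro Lp_modular_le_powr Lp_modular_divide_le_1) auto
    also have "\<dots> \<le> ennreal ((D * B) powr hi)"
      using D DB hi_pos by (intro ennreal_leI powr_mono2) auto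
    finally show "Lp_modular M p (eabs u) \<le> ennreal ((D * B) powr hi)" .
    obtain g where g: "g \<in> vec_gradients M s u" "\<And>k. Lp_modular M p (\<lambda>x. g k x / ennreal (D * B)) \<le> 1"
      using sem[OF less(2)[OF u]] by blast
    have "Lp_modular M p (g k) \<le> ennreal ((D * B) powr hi)" for k
      using g DB by (intro Lp_modular_le_powr) (auto simp: vec_gradients_def)
    with g(1) show "\<exists>g\<in>vec_gradients M s u. \<forall>k. Lp_modular M p (g k) \<le> ennreal ((D * B) powr hi)" by blast
  qed
qed

theorem compact_embeddings_if_finite_measure:
  fixes M :: "'a::metric_space measure"
  assumes M: "metric_measure_space M" and fin: "emeasure M (space M) < \<infinity>"
    and h: "\<forall>r. 0 < r \<and> r < 1 \<longrightarrow> 0 < (INF x. emeasure M (ball x r))"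
    and p: "p \<in> bdd_exponents M" and s: "s \<in> bdd_exponents M" and q: "q \<in> exponents M"
  shows "compactly_embedded (M_space M s p q) (M_norm M s p q) (Lp_space M p) (Lp_norm M p)"
    and "compactly_embedded (N_space M s p q) (N_norm M s p q) (Lp_space M p) (Lp_norm M p)"
proof -
  show "compactly_embedded (M_space M s p q) (M_norm M s p q) (Lp_space M p) (Lp_norm M p)"
  proof (rule compactly_embedded_if_gradients_controlled[OF M fin h p s])
    show "M_space M s p q \<subseteq> Lp_space M p" by (auto simp: M_space_def)
    show "M_norm M s p q u = Lp_norm M p u + M_seminorm M s p q u" for u by (rule M_norm_def)
    show "\<exists>g\<in>vec_gradients M s u. \<forall>k. Lp_modular M p (\<lambda>x. g k x / ennreal (D * 1)) \<le> 1"
      if "M_seminorm M s p q u < ennreal D" for u D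
      using that Lp_lq_qnorm_controls_terms[OF q] unfolding M_seminorm_def INF_less_iff mult_1_right by blast
  qed simp
  obtain B where B: "1 \<le> B" "\<And>p g D k. lq_Lp_qnorm M p q g < ennreal D \<Longrightarrow>
      Lp_modular M p (\<lambda>x. g k x / ennreal (D * B)) \<le> 1"
    using lq_Lp_qnorm_controls_terms[OF q] by blast
  show "compactly_embedded (N_space M s p q) (N_norm M s p q) (Lp_space M p) (Lp_norm M p)"
  proof (rule compactly_embedded_if_gradients_controlled[OF M fin h p s])
    show "N_space M s p q \<subseteq> Lp_space M p" by (auto simp: N_space_def)
    show "N_norm M s p q u = Lp_norm M p u + N_seminorm M s p q u" for u by (rule N_norm_def)
    show "\<exists>g\<in>vec_gradients M s u. \<forall>k. Lp_modular M p (\<lambda>x. g k x / ennreal (D * B)) \<le> 1"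
      if "N_seminorm M s p q u < ennreal D" for u D
      using that B(2) unfolding N_seminorm_def INF_less_iff by blast
  qed (rule B(1))
qed

section \<open>Bump functions and their gradients\<close>

definition bump :: "'a::metric_space \<Rightarrow> 'a \<Rightarrow> real" where
  "bump a x = max 0 (1 - 2 * dist x a)"

lemma bump_bounds: "0 \<le> bump a x" "bump a x \<le> 1"
  by (auto simp: bump_def)

lemma bump_lipschitz: "\<bar>bump a x - bump a y\<bar> \<le> 2 * dist x y"
  using dist_triangle[of x a y] dist_triangle[of y a x] by (auto simp: bump_def dist_commute)

lemma bump_eq_0: "x \<notin> ball a (1 / 2) \<Longrightarrow> bump a x = 0"
  by (auto simp: bump_def dist_commute)

lemma bump_measurable:
  assumes "metric_measure_space M"
  shows "(\<lambda>x. ereal (bump a x)) \<in> borel_measurable M"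
proof -
  have "bump a \<in> borel_measurable borel"
    unfolding bump_def by (intro borel_measurable_continuous_onI continuous_intros)
  hence "bump a \<in> borel_measurable M"
    using measurable_cong_sets[OF metric_measure_space_sets(1)[OF assms] refl] by blast
  thus ?thesis by simp
qed

text \<open>
  For \<open>k \<ge> 0\<close> the distance is at most \<open>1\<close> and the Lipschitz bound \<open>2 d = 2 d powr e * d powr (1 - e)\<close> is used,
  with \<open>1 - e \<ge> \<sigma>\<close>; for \<open>k < 0\<close> the distance is at least \<open>1\<close> and the bound \<open>1\<close> suffices, since
  \<open>d powr e \<ge> d powr \<sigma>\<close>.
\<close>
lemma oscillation_le_weighted_power:
  fixes d e \<sigma> t :: real and k :: int
  assumes "0 \<le> \<sigma>" "\<sigma> \<le> e" "e \<le> 1 - \<sigma>" and d: "2 powi (- k - 1) \<le> d" "d < 2 powi (- k)"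
    and t: "t \<le> 1" "t \<le> 2 * d"
  shows "t \<le> d powr e * (2 * 2 powr (- (\<sigma> * \<bar>of_int k\<bar>)))"
proof -
  have pow: "2 powi i = 2 powr (of_int i :: real)" for i by (simp add: powr_real_of_int')
  have d': "2 powr (- of_int k - 1) \<le> d" "d < 2 powr (- of_int k)"
    using d unfolding pow by simp_all
  have "0 < 2 powr (- of_int k - 1 :: real)" by simp
  with d'(1) have "0 < d" by linarith
  show ?thesis
  proof (cases "0 \<le> k")
    case True
    have "2 powr (- of_int k) \<le> (2 powr 0 :: real)" using True by (intro powr_mono) auto
    hence "d \<le> 1" using d'(2) by simp
    have "d powr (1 - e) \<le> d powr \<sigma>" using \<open>0 < d\<close> \<open>d \<le> 1\<close> assms by (intro powr_mono') auto
    also have "\<dots> \<le> (2 powr (- of_int k)) powr \<sigma>" using \<open>0 < d\<close> d' assms by (intro powr_mono2) auto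
    also have "\<dots> = 2 powr (- (\<sigma> * \<bar>of_int k\<bar>))" using True by (simp add: powr_powr mult.commute)
    finally have le: "d powr (1 - e) \<le> 2 powr (- (\<sigma> * \<bar>of_int k\<bar>))" .
    have "d = d powr e * d powr (1 - e)" using \<open>0 < d\<close> by (simp flip: powr_add)
    also have "\<dots> \<le> d powr e * 2 powr (- (\<sigma> * \<bar>of_int k\<bar>))" using le by (intro mult_left_mono) auto
    finally show ?thesis using t by simp
  next
    case False
    have "(2 powr 0 :: real) \<le> 2 powr (- of_int k - 1)" using False by (intro powr_mono) auto
    hence "1 \<le> d" using d'(1) by simp
    have "2 powr (\<sigma> * (- of_int k - 1)) = (2 powr (- of_int k - 1)) powr \<sigma>" by (simp add: powr_powr mult.commute)
    also have "\<dots> \<le> d powr \<sigma>" using d' assms by (intro powr_mono2) auto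
    also have "\<dots> \<le> d powr e" using \<open>1 \<le> d\<close> assms by (intro powr_mono) auto
    finally have "2 powr (\<sigma> * (- of_int k - 1)) * (2 * 2 powr (- (\<sigma> * \<bar>of_int k\<bar>)))
        \<le> d powr e * (2 * 2 powr (- (\<sigma> * \<bar>of_int k\<bar>)))" by (intro mult_right_mono) auto
    moreover have "2 powr (\<sigma> * (- of_int k - 1)) * (2 * 2 powr (- (\<sigma> * \<bar>of_int k\<bar>))) = 2 powr (1 - \<sigma>)"
    proof -
      have "2 * 2 powr (- (\<sigma> * \<bar>of_int k\<bar>)) = 2 powr (1 + (- (\<sigma> * \<bar>of_int k\<bar>)) :: real)"
        by (subst powr_add) simp
      hence "2 powr (\<sigma> * (- of_int k - 1)) * (2 * 2 powr (- (\<sigma> * \<bar>of_int k\<bar>)))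
          = 2 powr (\<sigma> * (- of_int k - 1) + (1 + (- (\<sigma> * \<bar>of_int k\<bar>))))"
        by (simp only: powr_add)
      also have "\<sigma> * (- of_int k - 1) + (1 + (- (\<sigma> * \<bar>of_int k\<bar>))) = 1 - \<sigma>"
        using False by (simp add: algebra_simps)
      finally show ?thesis .
    qed
    moreover have "1 \<le> 2 powr (1 - \<sigma>)" using assms by (intro ge_one_powr_ge_zero) auto
    ultimately show ?thesis using t by linarith
  qed
qed

text \<open>
  Of two points between which the bump varies, at least one lies in its supporting ball, and the term of
  that point alone dominates the difference.
\<close>
lemma bump_gradient:
  fixes M :: "'a::metric_space measure"
  assumes M: "metric_measure_space M" and "0 \<le> \<sigma>"
    and s: "AE x in M. \<sigma> \<le> enn2real (s x) \<and> enn2real (s x) \<le> 1 - \<sigma>"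
  shows "(\<lambda>k x. ennreal (2 * 2 powr (- (\<sigma> * \<bar>of_int k\<bar>))) * indicator (ball a (1 / 2)) x)
    \<in> vec_gradients M s (\<lambda>x. ereal (bump a x))"
proof -
  note sp = metric_measure_space_sets[OF M]
  define g :: "int \<Rightarrow> 'a \<Rightarrow> ennreal" where
    "g = (\<lambda>k x. ennreal (2 * 2 powr (- (\<sigma> * \<bar>of_int k\<bar>))) * indicator (ball a (1 / 2)) x)"
  have [measurable]: "ball a (1 / 2) \<in> sets M" using sp by simp
  have g_meas: "g k \<in> borel_measurable M" for k unfolding g_def by measurable
  obtain N where N: "N \<in> null_sets M"
    "{x \<in> space M. \<not> (\<sigma> \<le> enn2real (s x) \<and> enn2real (s x) \<le> 1 - \<sigma>)} \<subseteq> N"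
    using s unfolding eventually_ae_filter by blast
  have N': "\<sigma> \<le> enn2real (s x)" "enn2real (s x) \<le> 1 - \<sigma>" if "x \<notin> N" for x
    using subsetD[OF N(2), of x] that sp by auto
  have "e2ennreal \<bar>ereal (bump a x) - ereal (bump a y)\<bar> \<le>
      ennreal (dist x y powr enn2real (s x)) * g k x + ennreal (dist x y powr enn2real (s y)) * g k y"
    if "x \<notin> N" "y \<notin> N" and d: "2 powi (- k - 1) \<le> dist x y" "dist x y < 2 powi (- k)" for k x y
  proof -
    have t: "\<bar>bump a x - bump a y\<bar> \<le> 1" "\<bar>bump a x - bump a y\<bar> \<le> 2 * dist x y"
      using bump_bounds[of a x] bump_bounds[of a y] bump_lipschitz[of a x y] by auto
    have le: "ennreal \<bar>bump a x - bump a y\<bar> \<le> ennreal (dist x y powr enn2real (s z)) * g k z"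
      if "z \<notin> N" "z \<in> ball a (1 / 2)" for z
    proof -
      have "\<bar>bump a x - bump a y\<bar> \<le> dist x y powr enn2real (s z) * (2 * 2 powr (- (\<sigma> * \<bar>of_int k\<bar>)))"
        by (rule oscillation_le_weighted_power[OF \<open>0 \<le> \<sigma>\<close> N'[OF that(1)] d t])
      from ennreal_leI[OF this] show ?thesis
        using that(2) by (simp add: g_def ennreal_mult)
    qed
    consider "x \<in> ball a (1 / 2)" | "y \<in> ball a (1 / 2)" | "x \<notin> ball a (1 / 2)" "y \<notin> ball a (1 / 2)" by blast
    thus ?thesis
    proof cases
      case 1
      thus ?thesis using le[OF \<open>x \<notin> N\<close>] by (simp add: e2ennreal_ereal add_increasing2)
    next
      case 2
      thus ?thesis using le[OF \<open>y \<notin> N\<close>] by (simp add: e2ennreal_ereal add_increasing)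
    next
      case 3
      thus ?thesis by (simp add: bump_eq_0 e2ennreal_neg)
    qed
  qed
  hence "g \<in> vec_gradients M s (\<lambda>x. ereal (bump a x))"
    unfolding vec_gradients_def using g_meas N(1) by auto
  thus ?thesis unfolding g_def .
qed

section \<open>Mixed quasi-norms of weighted indicators\<close>

lemma sum_two_sided_geometric_bounded:
  assumes "0 < \<alpha>"
  obtains Z :: real where "0 < Z" "\<And>F. finite F \<Longrightarrow> (\<Sum>k\<in>F. 2 powr (- (\<alpha> * \<bar>of_int k\<bar>))) \<le> Z"
proof -
  define \<theta> :: real where "\<theta> = 2 powr (- \<alpha>)"
  have \<theta>: "0 < \<theta>" "\<theta> < 1" using assms by (auto simp: \<theta>_def intro: powr_less_one)
  have eq: "2 powr (- (\<alpha> * \<bar>of_int k\<bar>)) = \<theta> ^ nat \<bar>k\<bar>" for k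
    by (simp add: \<theta>_def powr_powr flip: powr_realpow)
  have part: "(\<Sum>k\<in>F. \<theta> ^ nat \<bar>k\<bar>) \<le> 1 / (1 - \<theta>)" if "finite F" "inj_on (\<lambda>k. nat \<bar>k\<bar>) F" for F :: "int set"
  proof -
    have "(\<Sum>k\<in>F. \<theta> ^ nat \<bar>k\<bar>) = (\<Sum>n\<in>(\<lambda>k. nat \<bar>k\<bar>) ` F. \<theta> ^ n)"
      by (subst sum.reindex[OF that(2)]) simp
    also have "\<dots> \<le> (\<Sum>n. \<theta> ^ n)"
      using \<theta> that(1) by (intro sum_le_suminf summable_geometric) auto
    also have "\<dots> = 1 / (1 - \<theta>)" using \<theta> by (simp add: suminf_geometric)
    finally show ?thesis .
  qed
  show ?thesis
  proof (rule that[of "2 / (1 - \<theta>)"])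
    show "0 < 2 / (1 - \<theta>)" using \<theta> by simp
    fix F :: "int set" assume F: "finite F"
    have "(\<Sum>k\<in>F. \<theta> ^ nat \<bar>k\<bar>) = (\<Sum>k\<in>F \<inter> {0..}. \<theta> ^ nat \<bar>k\<bar>) + (\<Sum>k\<in>F - {0..}. \<theta> ^ nat \<bar>k\<bar>)"
      using F by (rule sum.Int_Diff)
    also have "\<dots> \<le> 1 / (1 - \<theta>) + 1 / (1 - \<theta>)"
      using F by (intro add_mono part) (auto simp: inj_on_def)
    finally show "(\<Sum>k\<in>F. 2 powr (- (\<alpha> * \<bar>of_int k\<bar>))) \<le> 2 / (1 - \<theta>)" by (simp add: eq)
  qed
qed

lemma infsum_ennreal_le:
  fixes f :: "'b \<Rightarrow> ennreal"
  assumes "\<And>F. finite F \<Longrightarrow> sum f F \<le> b"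
  shows "infsum f UNIV \<le> b"
  using assms by (intro infsum_le_finite_sums nonneg_summable_on_complete) auto

lemma enn2real_inverse: "0 < q \<Longrightarrow> q \<noteq> \<infinity> \<Longrightarrow> enn2real (1 / q) = 1 / enn2real q"
  by (cases q) (auto simp: divide_ennreal_def inverse_ennreal inverse_eq_divide)

text \<open>
  The weights \<open>c k powr (1/q)\<close> are the extremal shape of a sequence in the unit ball of \<open>\<ell>\<^sup>q\<close>: their
  \<open>q\<close>-th powers are the summable \<open>c k\<close>, and they become \<open>1\<close> for \<open>q = \<infinity>\<close>. In this form finite
  and infinite \<open>q\<close>, and both mixed quasi-norms, are covered by a single hypothesis.
\<close>
lemma lq_qnorm_weighted_le:
  assumes "0 < q" "0 < \<Lambda>"
    and c: "\<And>k. 0 < c k" "\<And>F. finite F \<Longrightarrow> sum c F \<le> 1"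
    and a: "\<And>k. 0 \<le> a k" "\<And>k. a k \<le> \<Lambda> * c k powr enn2real (1 / q)"
  shows "lq_qnorm q (\<lambda>k. ennreal (a k)) \<le> ennreal \<Lambda>"
proof (cases "q = \<infinity>")
  case True
  have "a k \<le> \<Lambda>" for k using a(2)[of k] c(1)[of k] True by simp
  thus ?thesis using True by (auto simp: lq_qnorm_def intro!: SUP_least ennreal_leI)
next
  case False
  define e where "e = enn2real q"
  have e: "0 < e" using False assms(1) by (simp add: e_def enn2real_positive_iff less_top)
  have "(\<Sum>\<^sub>\<infinity>k. enn_powr (ennreal (a k)) e) \<le> ennreal (\<Lambda> powr e)"
  proof (rule infsum_ennreal_le)
    fix F :: "int set" assume F: "finite F"
    have "a k powr e \<le> \<Lambda> powr e * c k" for k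
    proof -
      have "a k powr e \<le> (\<Lambda> * c k powr (1 / e)) powr e"
        using a[of k] e enn2real_inverse[OF assms(1) False] by (intro powr_mono2) (auto simp: e_def)
      also have "\<dots> = \<Lambda> powr e * c k"
        using \<open>0 < \<Lambda>\<close> c(1)[of k] e by (simp add: powr_mult powr_powr)
      finally show ?thesis .
    qed
    hence "(\<Sum>k\<in>F. a k powr e) \<le> (\<Sum>k\<in>F. \<Lambda> powr e * c k)" by (intro sum_mono)
    also have "\<dots> = \<Lambda> powr e * sum c F" by (simp add: sum_distrib_left)
    also have "\<dots> \<le> \<Lambda> powr e" using mult_left_mono[OF c(2)[OF F], of "\<Lambda> powr e"] by simp
    finally have "ennreal (\<Sum>k\<in>F. a k powr e) \<le> ennreal (\<Lambda> powr e)" by (rule ennreal_leI)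
    thus "(\<Sum>k\<in>F. enn_powr (ennreal (a k)) e) \<le> ennreal (\<Lambda> powr e)"
      using a(1) by (simp add: enn_powr_ennreal)
  qed
  hence "lq_qnorm q (\<lambda>k. ennreal (a k)) \<le> enn_powr (ennreal (\<Lambda> powr e)) (1 / e)"
    using False e by (auto simp: lq_qnorm_def e_def intro: enn_powr_mono)
  also have "\<dots> = ennreal \<Lambda>" using e \<open>0 < \<Lambda>\<close> by (simp add: enn_powr_ennreal powr_powr)
  finally show ?thesis .
qed

lemma lq_qnorm_zero [simp]: "lq_qnorm q (\<lambda>_. 0) = 0"
  by (simp add: lq_qnorm_def)

text \<open>
  For the first quasi-norm, the inner \<open>\<ell>\<^sup>q\<close> quasi-norm is at most \<open>\<Lambda>\<close> on \<open>A\<close>; for the second, \<open>c k\<close> is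
  admissible in the infimum defining the \<open>k\<close>-th summand, so the mixed modular is at most the sum of the \<open>c k\<close>.
\<close>
lemma weighted_indicator_qnorms_le:
  assumes q: "q \<in> exponents M"
    and c: "\<And>k. 0 < c k" "\<And>F. finite F \<Longrightarrow> sum c F \<le> 1" and "0 < \<Lambda>"
    and a: "\<And>k. 0 \<le> a k" "AE x in M. \<forall>k. a k \<le> \<Lambda> * c k powr enn2real (1 / q x)"
    and "0 < \<tau>" and small: "Lp_modular M p (\<lambda>x. ennreal \<tau> * indicator A x) \<le> 1"
  shows "Lp_lq_qnorm M p q (\<lambda>k x. ennreal (a k) * indicator A x) \<le> ennreal (\<Lambda> / \<tau>)"
    and "lq_Lp_qnorm M p q (\<lambda>k x. ennreal (a k) * indicator A x) \<le> ennreal (\<Lambda> / \<tau>)"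
proof -
  have \<Lambda>\<tau>: "0 < \<Lambda> / \<tau>" using \<open>0 < \<Lambda>\<close> \<open>0 < \<tau>\<close> by simp
  have scale: "t / ennreal (\<Lambda> / \<tau>) = ennreal (\<tau> / \<Lambda>) * t" for t
    using divide_ennreal_ennreal[OF \<Lambda>\<tau>, of t] by simp
  have qpos: "0 < q x" if "x \<in> space M" for x using q that by (auto simp: exponents_def)
  show "Lp_lq_qnorm M p q (\<lambda>k x. ennreal (a k) * indicator A x) \<le> ennreal (\<Lambda> / \<tau>)"
    unfolding Lp_lq_qnorm_def
  proof (rule Lp_qnorm_le[OF \<Lambda>\<tau>])
    have "AE x in M. lq_qnorm (q x) (\<lambda>k. ennreal (a k) * indicator A x) / ennreal (\<Lambda> / \<tau>) \<le> ennreal \<tau> * indicator A x"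
      using AE_space a(2)
    proof eventually_elim
      case (elim x)
      show ?case
      proof (cases "x \<in> A")
        case True
        have "lq_qnorm (q x) (\<lambda>k. ennreal (a k)) \<le> ennreal \<Lambda>"
          using elim by (intro lq_qnorm_weighted_le[OF qpos \<open>0 < \<Lambda>\<close> c a(1)]) auto
        hence "ennreal (\<tau> / \<Lambda>) * lq_qnorm (q x) (\<lambda>k. ennreal (a k)) \<le> ennreal (\<tau> / \<Lambda>) * ennreal \<Lambda>"
          by (rule mult_left_mono) simp
        also have "\<dots> = ennreal \<tau>" using \<open>0 < \<Lambda>\<close> \<open>0 < \<tau>\<close> by (simp flip: ennreal_mult)
        finally show ?thesis using True by (simp add: scale)
      next
        case False
        thus ?thesis by simp
      qed
    qed
    hence "Lp_modular M p (\<lambda>x. lq_qnorm (q x) (\<lambda>k. ennreal (a k) * indicator A x) / ennreal (\<Lambda> / \<tau>))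
        \<le> Lp_modular M p (\<lambda>x. ennreal \<tau> * indicator A x)" by (rule Lp_modular_mono)
    thus "Lp_modular M p (\<lambda>x. lq_qnorm (q x) (\<lambda>k. ennreal (a k) * indicator A x) / ennreal (\<Lambda> / \<tau>)) \<le> 1"
      using small by (rule order_trans)
  qed
  have "lq_Lp_modular M p q (\<lambda>k x. ennreal (a k) * indicator A x / ennreal (\<Lambda> / \<tau>)) \<le> 1"
    unfolding lq_Lp_modular_def
  proof (rule infsum_ennreal_le)
    fix F :: "int set" assume F: "finite F"
    have "Inf {ennreal d |d. 0 < d \<and> Lp_modular M p (\<lambda>x. ennreal (a k) * indicator A x / ennreal (\<Lambda> / \<tau>)
        / ennreal (d powr enn2real (1 / q x))) \<le> 1} \<le> ennreal (c k)" for k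
    proof (rule Inf_lower, intro CollectI exI[of _ "c k"] conjI)
      show "ennreal (c k) = ennreal (c k)" "0 < c k" using c(1) by simp_all
      have "AE x in M. ennreal (a k) * indicator A x / ennreal (\<Lambda> / \<tau>) / ennreal (c k powr enn2real (1 / q x))
          \<le> ennreal \<tau> * indicator A x"
        using a(2)
      proof eventually_elim
        case (elim x)
        define w where "w = c k powr enn2real (1 / q x)"
        have w: "0 < w" "a k \<le> \<Lambda> * w" using c(1)[of k] elim by (auto simp: w_def)
        have "1 / w * (\<tau> / \<Lambda> * a k) \<le> \<tau>"
          using w \<open>0 < \<Lambda>\<close> mult_left_mono[OF w(2), of "\<tau> / \<Lambda>"] \<open>0 < \<tau>\<close> by (simp add: pos_divide_le_eq mult.commute)
        from ennreal_leI[OF this] have "ennreal (1 / w) * (ennreal (\<tau> / \<Lambda>) * ennreal (a k)) \<le> ennreal \<tau>"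
          using w(1) a(1)[of k] \<open>0 < \<Lambda>\<close> \<open>0 < \<tau>\<close> by (simp flip: ennreal_mult)
        thus ?case unfolding w_def[symmetric] using w(1)
          by (simp add: scale divide_ennreal_ennreal indicator_def)
      qed
      from Lp_modular_mono[OF this] show "Lp_modular M p (\<lambda>x. ennreal (a k) * indicator A x / ennreal (\<Lambda> / \<tau>)
          / ennreal (c k powr enn2real (1 / q x))) \<le> 1" using small by (rule order_trans)
    qed
    hence "(\<Sum>k\<in>F. Inf {ennreal d |d. 0 < d \<and> Lp_modular M p (\<lambda>x. ennreal (a k) * indicator A x / ennreal (\<Lambda> / \<tau>)
        / ennreal (d powr enn2real (1 / q x))) \<le> 1}) \<le> (\<Sum>k\<in>F. ennreal (c k))" by (intro sum_mono)
    also have "\<dots> = ennreal (sum c F)" using c(1) by (intro sum_ennreal) (auto intro: less_imp_le)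
    also have "\<dots> \<le> 1" using c(2)[OF F] by simp
    finally show "(\<Sum>k\<in>F. Inf {ennreal d |d. 0 < d \<and> Lp_modular M p (\<lambda>x. ennreal (a k) * indicator A x / ennreal (\<Lambda> / \<tau>)
        / ennreal (d powr enn2real (1 / q x))) \<le> 1}) \<le> 1" .
  qed
  thus "lq_Lp_qnorm M p q (\<lambda>k x. ennreal (a k) * indicator A x) \<le> ennreal (\<Lambda> / \<tau>)"
    unfolding lq_Lp_qnorm_def using \<Lambda>\<tau> by (intro Inf_lower) blast
qed

lemma AE_infinite_if_essinf_infinite:
  assumes "essinf M q = \<infinity>"
  shows "AE x in M. q x = \<infinity>"
proof -
  have "AE x in M. of_nat n \<le> q x" for n :: nat
  proof -
    have "of_nat n < essinf M q" using assms by (simp add: of_nat_less_top)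
    then obtain z where "of_nat n < z" "AE x in M. z \<le> q x" unfolding essinf_def less_Sup_iff by auto
    thus ?thesis by (auto elim!: eventually_mono)
  qed
  hence "AE x in M. \<forall>n::nat. of_nat n \<le> q x" by (simp add: AE_all_countable)
  thus ?thesis
  proof eventually_elim
    case (elim x)
    show ?case
    proof (rule ccontr)
      assume "q x \<noteq> \<infinity>"
      then obtain n where "q x < of_nat n" using ennreal_Ex_less_of_nat by (auto simp: less_top)
      thus False using elim by (meson not_le)
    qed
  qed
qed

text \<open>
  If \<open>s\<^sup>+ < 1\<close>, some \<open>\<sigma> > 0\<close> is possible and the coefficients decay geometrically; their \<open>q0\<close>-th powers,
  normalised to have sum at most \<open>1\<close>, serve as weights, where \<open>q0\<close> is a positive lower bound of \<open>q\<close>. If \<open>q = \<infinity>\<close>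
  almost everywhere, then \<open>c k powr (1/q) = 1\<close> for any weights and \<open>\<sigma> = 0\<close> will do.
\<close>
lemma exists_gradient_weights:
  assumes s: "s \<in> bdd_exponents M" and q: "q \<in> exponents M"
    and cond: "esssup M s < 1 \<or> esssup M s \<le> 1 \<and> essinf M q = \<infinity>"
  obtains \<sigma> \<Lambda> :: real and c :: "int \<Rightarrow> real" where
    "0 \<le> \<sigma>" "AE x in M. \<sigma> \<le> enn2real (s x) \<and> enn2real (s x) \<le> 1 - \<sigma>" "0 < \<Lambda>" "\<And>k. 0 < c k"
    "\<And>F. finite F \<Longrightarrow> sum c F \<le> 1"
    "AE x in M. \<forall>k. 2 * 2 powr (- (\<sigma> * \<bar>of_int k\<bar>)) \<le> \<Lambda> * c k powr enn2real (1 / q x)"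
proof (cases "esssup M s < 1")
  case True
  obtain lo hi where "bounded_exponent M s lo hi" using bdd_exponents_bounded_exponent[OF s] .
  then interpret s: bounded_exponent M s lo hi .
  obtain s1 where s1: "0 \<le> s1" "esssup M s = ennreal s1" using True by (cases "esssup M s") auto
  have "s1 < 1" using True s1 by simp
  define \<sigma> where "\<sigma> = min lo (1 - s1)"
  have \<sigma>: "0 < \<sigma>" using s.lo_pos \<open>s1 < 1\<close> by (simp add: \<sigma>_def)
  have "AE x in M. s x \<le> ennreal s1" using esssup_AE[of s M] s1 by simp
  with s.bounds have AE_s: "AE x in M. \<sigma> \<le> enn2real (s x) \<and> enn2real (s x) \<le> 1 - \<sigma>"
  proof eventually_elim
    case (elim x)
    hence "enn2real (s x) \<le> s1" using enn2real_mono[of "s x" "ennreal s1"] s1 by simp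
    thus ?case using elim by (auto simp: \<sigma>_def)
  qed
  obtain q0 where q0: "0 < q0" "AE x in M. ennreal q0 \<le> q x" using exponents_lower_bound[OF q] .
  obtain Z where Z: "0 < Z" "\<And>F. finite F \<Longrightarrow> (\<Sum>k\<in>F. 2 powr (- (\<sigma> * q0 * \<bar>of_int k\<bar>))) \<le> Z"
    using sum_two_sided_geometric_bounded[of "\<sigma> * q0"] \<sigma> q0 by auto
  define c where "c = (\<lambda>k. 2 powr (- (\<sigma> * q0 * \<bar>of_int k\<bar>)) / Z)"
  have c: "0 < c k" for k using Z by (simp add: c_def)
  have csum: "sum c F \<le> 1" if "finite F" for F
    using Z(2)[OF that] Z(1) by (simp add: c_def pos_divide_le_eq flip: sum_divide_distrib)
  show ?thesis
  proof (rule that[OF less_imp_le[OF \<sigma>] AE_s, of "2 * Z powr (1 / q0)" c])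
    show "AE x in M. \<forall>k. 2 * 2 powr (- (\<sigma> * \<bar>of_int k\<bar>)) \<le> 2 * Z powr (1 / q0) * c k powr enn2real (1 / q x)"
      using q0(2)
    proof eventually_elim
      case (elim x)
      have r: "enn2real (1 / q x) \<le> 1 / q0"
      proof (cases "q x = \<infinity>")
        case False
        hence "q0 \<le> enn2real (q x)" using elim q0(1) enn2real_mono[of "ennreal q0" "q x"] by (simp add: less_top)
        moreover have "0 < q x" using elim q0(1) by (metis ennreal_less_zero_iff order_less_le_trans)
        ultimately show ?thesis using False q0(1) by (simp add: enn2real_inverse divide_left_mono)
      qed (use q0 in simp)
      show ?case
      proof
        fix k
        have "c k \<le> 1" using csum[of "{k}"] by simp
        have "2 powr (- (\<sigma> * \<bar>of_int k\<bar>)) = Z powr (1 / q0) * c k powr (1 / q0)"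
          using Z(1) q0(1) by (simp add: c_def powr_divide powr_powr)
        also have "\<dots> \<le> Z powr (1 / q0) * c k powr enn2real (1 / q x)"
          using r c[of k] \<open>c k \<le> 1\<close> by (intro mult_left_mono powr_mono') auto
        finally show "2 * 2 powr (- (\<sigma> * \<bar>of_int k\<bar>)) \<le> 2 * Z powr (1 / q0) * c k powr enn2real (1 / q x)" by simp
      qed
    qed
  qed (use Z c csum in auto)
next
  case False
  hence le: "esssup M s \<le> 1" and inf: "essinf M q = \<infinity>" using cond by auto
  have "AE x in M. s x \<le> 1" using esssup_AE[of s M] le by (auto elim!: eventually_mono)
  hence AE_s: "AE x in M. 0 \<le> enn2real (s x) \<and> enn2real (s x) \<le> 1 - 0"
    by eventually_elim (use enn2real_mono[of _ 1] in auto)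
  obtain Z :: real where Z: "0 < Z" "\<And>F. finite F \<Longrightarrow> (\<Sum>k\<in>F. 2 powr (- (1 * \<bar>of_int k\<bar>))) \<le> Z"
    using sum_two_sided_geometric_bounded[of 1] by auto
  show ?thesis
  proof (rule that[OF order_refl AE_s, of 2 "\<lambda>k. 2 powr (- (1 * \<bar>of_int k\<bar>)) / Z"])
    show "(\<Sum>k\<in>F. 2 powr (- (1 * \<bar>of_int k\<bar>)) / Z) \<le> 1" if "finite F" for F
      using Z(2)[OF that] Z(1) by (simp add: pos_divide_le_eq flip: sum_divide_distrib)
    show "AE x in M. \<forall>k. 2 * 2 powr (- (0 * \<bar>of_int k\<bar>)) \<le>
        2 * (2 powr (- (1 * \<bar>of_int k\<bar>)) / Z) powr enn2real (1 / q x)"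
      using AE_infinite_if_essinf_infinite[OF inf] by eventually_elim (use Z in simp)
  qed (use Z in auto)
qed


section \<open>Failure of compactness for infinite measure\<close>

text \<open>
  All bounds are uniform in the centre \<open>a\<close> because the measures of the supporting balls are: the factor
  \<open>\<tau>\<close> brings the modular of every indicator of such a ball below \<open>1\<close>.
\<close>
lemma bump_in_spaces:
  fixes M :: "'a::metric_space measure"
  assumes M: "metric_measure_space M" and m: "(SUP x. emeasure M (ball x 1)) < \<infinity>"
    and p: "p \<in> bdd_exponents M" and s: "s \<in> bdd_exponents M" and q: "q \<in> exponents M"
    and cond: "esssup M s < 1 \<or> esssup M s \<le> 1 \<and> essinf M q = \<infinity>"
  obtains C :: real where
    "\<And>a. (\<lambda>x. ereal (bump a x)) \<in> M_space M s p q" "\<And>a. M_norm M s p q (\<lambda>x. ereal (bump a x)) \<le> ennreal C"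
    "\<And>a. (\<lambda>x. ereal (bump a x)) \<in> N_space M s p q" "\<And>a. N_norm M s p q (\<lambda>x. ereal (bump a x)) \<le> ennreal C"
proof -
  note sp = metric_measure_space_sets[OF M]
  obtain lo hi where "bounded_exponent M p lo hi" using bdd_exponents_bounded_exponent[OF p] .
  then interpret bounded_exponent M p lo hi .
  obtain \<sigma> \<Lambda> :: real and c :: "int \<Rightarrow> real" where weights:
    "0 \<le> \<sigma>" "AE x in M. \<sigma> \<le> enn2real (s x) \<and> enn2real (s x) \<le> 1 - \<sigma>" "0 < \<Lambda>" "\<And>k. 0 < c k"
    "\<And>F. finite F \<Longrightarrow> sum c F \<le> 1"
    "AE x in M. \<forall>k. 2 * 2 powr (- (\<sigma> * \<bar>of_int k\<bar>)) \<le> \<Lambda> * c k powr enn2real (1 / q x)"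
    by (rule exists_gradient_weights[OF s q cond]) (rule that)
  obtain V where V: "0 \<le> V" "(SUP x. emeasure M (ball x 1)) = ennreal V"
    using m by (cases "SUP x. emeasure M (ball x 1)") auto
  have ball_le: "emeasure M (ball a (1 / 2)) \<le> ennreal V" for a
  proof -
    have "emeasure M (ball a (1 / 2)) \<le> emeasure M (ball a 1)"
      by (intro emeasure_mono subset_ball) (auto simp: sp)
    also have "\<dots> \<le> ennreal V" unfolding V(2)[symmetric] by (rule SUP_upper) simp
    finally show ?thesis .
  qed
  define \<tau> where "\<tau> = (1 / (V + 1)) powr (1 / lo)"
  have \<tau>: "0 < \<tau>" "\<tau> \<le> 1" "\<tau> powr lo = 1 / (V + 1)"
    using V(1) lo_pos by (auto simp: \<tau>_def powr_powr intro!: powr_le1)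
  have small: "Lp_modular M p (\<lambda>x. ennreal \<tau> * indicator (ball a (1 / 2)) x) \<le> 1" for a
  proof -
    have "Lp_modular M p (\<lambda>x. ennreal \<tau> * indicator (ball a (1 / 2)) x) \<le> ennreal (\<tau> powr lo) * emeasure M (ball a (1 / 2))"
      using \<tau> sp by (intro Lp_modular_indicator_le) auto
    also have "\<dots> \<le> ennreal (\<tau> powr lo) * ennreal V" by (intro mult_left_mono ball_le) simp
    also have "\<dots> \<le> 1" unfolding \<tau>(3) using V(1) by (simp flip: ennreal_mult)
    finally show ?thesis .
  qed
  define b :: "'a \<Rightarrow> 'a \<Rightarrow> ereal" where "b = (\<lambda>a x. ereal (bump a x))"
  have b_le: "eabs (b a) x \<le> indicator (ball a (1 / 2)) x" for a x
    using bump_bounds[of a x] bump_eq_0[of x a]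
    by (cases "x \<in> ball a (1 / 2)") (auto simp: eabs_def b_def e2ennreal_ereal e2ennreal_neg simp flip: ennreal_1 intro!: ennreal_leI)
  have modular_b: "Lp_modular M p (\<lambda>x. ennreal \<tau> * eabs (b a) x) \<le> 1" for a
  proof -
    have "Lp_modular M p (\<lambda>x. ennreal \<tau> * eabs (b a) x) \<le> Lp_modular M p (\<lambda>x. ennreal \<tau> * indicator (ball a (1 / 2)) x)"
      by (intro Lp_modular_mono AE_I2 mult_left_mono b_le) simp
    thus ?thesis using small by (rule order_trans)
  qed
  have norm_b: "Lp_norm M p (b a) \<le> ennreal (1 / \<tau>)" for a
    unfolding Lp_norm_def using \<tau>(1) modular_b[of a]
    by (intro Lp_qnorm_le) (simp_all add: divide_ennreal_ennreal)
  have Lp_b: "b a \<in> Lp_space M p" for a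
    unfolding Lp_space_def using bump_measurable[OF M, of a] \<tau>(1) order.strict_trans1[OF modular_b[of a], of \<infinity>]
    by (auto simp: b_def intro!: exI[of _ \<tau>])
  define g :: "'a \<Rightarrow> int \<Rightarrow> 'a \<Rightarrow> ennreal" where
    "g = (\<lambda>a k x. ennreal (2 * 2 powr (- (\<sigma> * \<bar>of_int k\<bar>))) * indicator (ball a (1 / 2)) x)"
  have g: "g a \<in> vec_gradients M s (b a)" for a
    unfolding g_def b_def by (rule bump_gradient[OF M weights(1,2)])
  have g_norms: "Lp_lq_qnorm M p q (g a) \<le> ennreal (\<Lambda> / \<tau>)" "lq_Lp_qnorm M p q (g a) \<le> ennreal (\<Lambda> / \<tau>)" for a
    unfolding g_def
    by (rule weighted_indicator_qnorms_le[OF q weights(4,5,3) _ weights(6) \<tau>(1) small], simp_all)+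
  have M_b: "M_seminorm M s p q (b a) \<le> ennreal (\<Lambda> / \<tau>)" for a
    unfolding M_seminorm_def by (rule order_trans[OF INF_lower[OF g[of a], of "Lp_lq_qnorm M p q"] g_norms(1)])
  have N_b: "N_seminorm M s p q (b a) \<le> ennreal (\<Lambda> / \<tau>)" for a
    unfolding N_seminorm_def by (rule order_trans[OF INF_lower[OF g[of a], of "lq_Lp_qnorm M p q"] g_norms(2)])
  have sum_eq: "ennreal (1 / \<tau>) + ennreal (\<Lambda> / \<tau>) = ennreal (1 / \<tau> + \<Lambda> / \<tau>)"
    using \<tau>(1) weights(3) by (simp add: ennreal_plus)
  have "b a \<in> M_space M s p q" "b a \<in> N_space M s p q" for a
    using Lp_b[of a] order.strict_trans1[OF M_b[of a], of \<infinity>] order.strict_trans1[OF N_b[of a], of \<infinity>]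
    by (auto simp: M_space_def N_space_def)
  moreover have "M_norm M s p q (b a) \<le> ennreal (1 / \<tau> + \<Lambda> / \<tau>)" for a
    unfolding M_norm_def sum_eq[symmetric] by (intro add_mono norm_b M_b)
  moreover have "N_norm M s p q (b a) \<le> ennreal (1 / \<tau> + \<Lambda> / \<tau>)" for a
    unfolding N_norm_def sum_eq[symmetric] by (intro add_mono norm_b N_b)
  ultimately show ?thesis unfolding b_def by (intro that) assumption+
qed

text \<open>
  Near \<open>a\<close> the two bumps differ by at least \<open>1/2\<close>, so a common approximant \<open>v\<close> is off by at least \<open>1/4\<close>
  from one of them there. At distance \<open>\<epsilon> = 1/(4T)\<close> the two modulars would add up to at most \<open>2\<close>, but
  they are at least \<open>T powr lo\<close> times the measure of the ball, hence at least \<open>3\<close>.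
\<close>
lemma separated_bumps_not_close:
  fixes M :: "'a::metric_space measure"
  assumes M: "metric_measure_space M" and \<beta>: "bounded_exponent M \<beta> lo hi"
    and h: "0 < h0" "\<And>x. ennreal h0 \<le> emeasure M (ball x (1 / 4))"
  obtains \<epsilon> :: real where "0 < \<epsilon>"
    "\<And>v a b. \<lbrakk>v \<in> borel_measurable M; 1 \<le> dist a b; Lp_norm M \<beta> (\<lambda>x. ereal (bump a x) - v x) < ennreal \<epsilon>;
       Lp_norm M \<beta> (\<lambda>x. ereal (bump b x) - v x) < ennreal \<epsilon>\<rbrakk> \<Longrightarrow> False"
proof -
  interpret bounded_exponent M \<beta> lo hi by fact
  note sp = metric_measure_space_sets[OF M]
  define T where "T = max 1 ((3 / h0) powr (1 / lo))"
  have T: "1 \<le> T" by (simp add: T_def)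
  have "3 / h0 = ((3 / h0) powr (1 / lo)) powr lo" using h(1) lo_pos by (simp add: powr_powr)
  also have "\<dots> \<le> T powr lo" using lo_pos by (intro powr_mono2) (auto simp: T_def)
  finally have T3: "3 \<le> T powr lo * h0" using h(1) by (simp add: pos_divide_le_eq)
  define \<epsilon> where "\<epsilon> = 1 / (4 * T)"
  have \<epsilon>: "0 < \<epsilon>" using T by (simp add: \<epsilon>_def)
  show ?thesis
  proof (rule that[OF \<epsilon>])
    fix v and a b :: 'a
    assume v [measurable]: "v \<in> borel_measurable M" and ab: "1 \<le> dist a b"
      and close: "Lp_norm M \<beta> (\<lambda>x. ereal (bump a x) - v x) < ennreal \<epsilon>"
        "Lp_norm M \<beta> (\<lambda>x. ereal (bump b x) - v x) < ennreal \<epsilon>"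
    define f where "f = (\<lambda>c x. eabs (\<lambda>x. ereal (bump c x) - v x) x)"
    have [measurable]: "(\<lambda>x. ereal (bump c x)) \<in> borel_measurable M" for c by (rule bump_measurable[OF M])
    have [measurable]: "f c \<in> borel_measurable M" for c unfolding f_def eabs_def by measurable
    have [measurable]: "ball a (1 / 4) \<in> sets M" using sp by simp
    have modular: "Lp_modular M \<beta> (\<lambda>x. f c x / ennreal \<epsilon>) \<le> 1" if "c \<in> {a, b}" for c
      using that close unfolding Lp_norm_def f_def by (auto intro: Lp_modular_divide_le_1)
    have "AE x in M. ennreal (T powr lo) * indicator (ball a (1 / 4)) x \<le>
        enn_powr (f a x / ennreal \<epsilon>) (enn2real (\<beta> x)) + enn_powr (f b x / ennreal \<epsilon>) (enn2real (\<beta> x))"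
      using bounds
    proof eventually_elim
      case (elim x)
      show ?case
      proof (cases "x \<in> ball a (1 / 4)")
        case True
        hence xa: "dist x a < 1 / 4" by (simp add: dist_commute)
        have "3 / 4 < dist x b" using xa ab dist_triangle[of a b x] by (simp add: dist_commute)
        hence b0: "bump b x = 0" by (intro bump_eq_0) (simp add: dist_commute)
        have a1: "1 / 2 \<le> bump a x" using xa by (simp add: bump_def)
        have one_far: "ennreal (1 / 4) \<le> f a x \<or> ennreal (1 / 4) \<le> f b x"
        proof (cases "v x")
          case (real r)
          have "1 / 4 \<le> \<bar>bump a x - r\<bar> \<or> 1 / 4 \<le> \<bar>r\<bar>" using a1 by linarith
          thus ?thesis using real b0 by (auto simp: f_def eabs_def e2ennreal_ereal intro: ennreal_leI)
        qed (auto simp: f_def eabs_def)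
        have far: "ennreal (T powr lo) \<le> enn_powr (f c x / ennreal \<epsilon>) (enn2real (\<beta> x))"
          if c: "ennreal (1 / 4) \<le> f c x" for c
        proof -
          have "ennreal T = ennreal (1 / \<epsilon>) * ennreal (1 / 4)"
            using T by (simp add: \<epsilon>_def flip: ennreal_mult)
          also have "\<dots> \<le> f c x / ennreal \<epsilon>"
            unfolding divide_ennreal_ennreal[OF \<epsilon>] by (rule mult_left_mono[OF c]) simp
          finally have le: "ennreal T \<le> f c x / ennreal \<epsilon>" .
          have "ennreal (T powr lo) \<le> ennreal (T powr enn2real (\<beta> x))"
            using elim T by (intro ennreal_leI powr_mono) auto
          also have "\<dots> = enn_powr (ennreal T) (enn2real (\<beta> x))" using T by (simp add: enn_powr_ennreal)
          also have "\<dots> \<le> enn_powr (f c x / ennreal \<epsilon>) (enn2real (\<beta> x))"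
            using le by (rule enn_powr_mono) simp
          finally show ?thesis .
        qed
        from one_far show ?thesis
        proof
          assume "ennreal (1 / 4) \<le> f a x"
          from far[OF this] show ?thesis using True by (simp add: add_increasing2)
        next
          assume "ennreal (1 / 4) \<le> f b x"
          from far[OF this] show ?thesis using True by (simp add: add_increasing)
        qed
      qed simp
    qed
    hence "(\<integral>\<^sup>+x. ennreal (T powr lo) * indicator (ball a (1 / 4)) x \<partial>M) \<le>
        (\<integral>\<^sup>+x. enn_powr (f a x / ennreal \<epsilon>) (enn2real (\<beta> x)) + enn_powr (f b x / ennreal \<epsilon>) (enn2real (\<beta> x)) \<partial>M)"
      by (rule nn_integral_mono_AE)
    also have "\<dots> = Lp_modular M \<beta> (\<lambda>x. f a x / ennreal \<epsilon>) + Lp_modular M \<beta> (\<lambda>x. f b x / ennreal \<epsilon>)"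
      by (simp add: nn_integral_add Lp_modular_def)
    also have "\<dots> \<le> 1 + 1" by (intro add_mono modular) auto
    finally have le2: "ennreal (T powr lo) * emeasure M (ball a (1 / 4)) \<le> ennreal 2"
      by (simp add: nn_integral_cmult)
    have "ennreal 3 \<le> ennreal (T powr lo * h0)" using T3 by (rule ennreal_leI)
    also have "\<dots> = ennreal (T powr lo) * ennreal h0" using h(1) by (intro ennreal_mult) auto
    also have "\<dots> \<le> ennreal (T powr lo) * emeasure M (ball a (1 / 4))"
      by (intro mult_left_mono h(2)) simp
    also note le2
    finally have "ennreal 3 \<le> ennreal 2" .
    thus False by (simp add: ennreal_le_iff del: ennreal_numeral)
  qed
qed

text \<open>
  A finite net with \<open>N\<close> elements would assign a common approximant to two of the bumps around \<open>N + 1\<close>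
  points of mutual distance at least \<open>1\<close>.
\<close>
lemma not_compactly_embedded_if_infinite_measure:
  fixes M :: "'a::metric_space measure"
  assumes M: "metric_measure_space M" and m: "(SUP x. emeasure M (ball x 1)) < \<infinity>"
    and h: "0 < (INF x. emeasure M (ball x (1 / 4)))" and inf: "emeasure M (space M) = \<infinity>"
    and \<beta>: "\<beta> \<in> bdd_exponents M"
    and Y: "\<And>a. (\<lambda>x. ereal (bump a x)) \<in> Y" "\<And>a. nY (\<lambda>x. ereal (bump a x)) \<le> ennreal C"
  shows "\<not> compactly_embedded Y nY (Lp_space M \<beta>) (Lp_norm M \<beta>)"
proof
  assume emb: "compactly_embedded Y nY (Lp_space M \<beta>) (Lp_norm M \<beta>)"
  note sp = metric_measure_space_sets[OF M]
  define b :: "'a \<Rightarrow> 'a \<Rightarrow> ereal" where "b = (\<lambda>a x. ereal (bump a x))"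
  have "\<not> (\<exists>T::'a set. finite T \<and> (\<forall>x. \<exists>t\<in>T. dist t x < 1))"
  proof
    assume "\<exists>T::'a set. finite T \<and> (\<forall>x. \<exists>t\<in>T. dist t x < 1)"
    then obtain T :: "'a set" where T: "finite T" "\<And>x. \<exists>t\<in>T. dist t x < 1" by blast
    have "emeasure M (space M) = emeasure M (\<Union>t\<in>T. ball t 1)"
      using T(2) sp by (intro arg_cong[of _ _ "emeasure M"]) auto
    also have "\<dots> \<le> (\<Sum>t\<in>T. emeasure M (ball t 1))"
      using T(1) sp by (intro emeasure_subadditive_finite) auto
    also have "\<dots> < \<infinity>"
      using M T(1) by (simp add: metric_measure_space_def)
    finally show False using inf by simp
  qed
  moreover have "(0::real) < 1" by simp
  ultimately have separated: "\<exists>A::'a set. finite A \<and> card A = n \<and> (\<forall>x\<in>A. \<forall>y\<in>A. x \<noteq> y \<longrightarrow> 1 \<le> dist x y)" for n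
    using finite_cover_or_separated[where ?'a = 'a] by blast
  obtain lo hi where \<beta>': "bounded_exponent M \<beta> lo hi" using bdd_exponents_bounded_exponent[OF \<beta>] .
  obtain h0 where h0: "0 < h0" "ennreal h0 \<le> (INF x. emeasure M (ball x (1 / 4)))"
    using ennreal_pos_real_lower_bound[OF h] .
  have h0': "ennreal h0 \<le> emeasure M (ball x (1 / 4))" for x
    using h0(2) by (simp add: le_INF_iff)
  obtain \<epsilon> :: real where \<epsilon>: "0 < \<epsilon>"
    "\<And>v a a'. \<lbrakk>v \<in> borel_measurable M; 1 \<le> dist a a'; Lp_norm M \<beta> (\<lambda>x. b a x - v x) < ennreal \<epsilon>;
       Lp_norm M \<beta> (\<lambda>x. b a' x - v x) < ennreal \<epsilon>\<rbrakk> \<Longrightarrow> False"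
    unfolding b_def by (rule separated_bumps_not_close[OF M \<beta>' h0(1) h0']) blast
  have "range b \<subseteq> Y" "qnorm_bounded nY (range b)"
    using Y unfolding qnorm_bounded_def b_def by blast+
  hence "qnorm_totally_bounded (Lp_space M \<beta>) (Lp_norm M \<beta>) (range b)"
    using emb unfolding compactly_embedded_def by blast
  then obtain K where K: "finite K" "K \<subseteq> Lp_space M \<beta>"
    "\<forall>u\<in>range b. \<exists>v\<in>K. Lp_norm M \<beta> (\<lambda>x. u x - v x) < ennreal \<epsilon>"
    unfolding qnorm_totally_bounded_def using \<epsilon>(1) by meson
  have "\<forall>a. \<exists>v. v \<in> K \<and> Lp_norm M \<beta> (\<lambda>x. b a x - v x) < ennreal \<epsilon>"
    using bspec[OF K(3) rangeI] by blast
  from choice[OF this] obtain near where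
    near: "\<And>a. near a \<in> K" "\<And>a. Lp_norm M \<beta> (\<lambda>x. b a x - near a x) < ennreal \<epsilon>" by blast
  obtain A :: "'a set" where A: "finite A" "card A = Suc (card K)"
    "\<And>x y. x \<in> A \<Longrightarrow> y \<in> A \<Longrightarrow> x \<noteq> y \<Longrightarrow> 1 \<le> dist x y"
    using separated[of "Suc (card K)"] by auto
  have "card (near ` A) \<le> card K" using near(1) K(1) by (intro card_mono) auto
  hence "\<not> inj_on near A" using A(2) by (auto dest: card_image)
  then obtain x y where xy: "x \<in> A" "y \<in> A" "x \<noteq> y" "near x = near y" unfolding inj_on_def by blast
  have "near x \<in> borel_measurable M" using near(1) K(2) by (auto simp: Lp_space_def)
  thus False using \<epsilon>(2)[of "near x" x y] A(3)[OF xy(1-3)] near(2)[of x] near(2)[of y] xy(4) by simp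
qed

section \<open>The equivalence\<close>

lemma essinf_const_le:
  assumes "emeasure M (space M) \<noteq> 0"
  shows "essinf M (\<lambda>_. c) \<le> c"
  unfolding essinf_def
proof (rule Sup_least, rule CollectD[of _ "\<lambda>z. z \<le> c"], rule CollectI)
  fix z assume "z \<in> {z. AE x in M. z \<le> c}"
  hence "AE x in M. z \<le> c" by simp
  thus "z \<le> c" using assms by (simp add: eventually_const ae_filter_eq_bot_iff)
qed

lemma esssup_const_le: "esssup M (\<lambda>_. c) \<le> (c :: ennreal)"
  by (rule esssup_I) auto

lemma const_bdd_exponent:
  fixes c :: ennreal
  assumes "0 < c" "c < \<infinity>"
  shows "(\<lambda>_. c) \<in> bdd_exponents M"
proof -
  have "c \<le> essinf M (\<lambda>_. c)" unfolding essinf_def by (rule Sup_upper) simp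
  hence "0 < essinf M (\<lambda>_. c)" using assms(1) by (rule order.strict_trans2[rotated])
  moreover have "esssup M (\<lambda>_. c) < \<infinity>" using esssup_const_le assms(2) by (rule order.strict_trans1)
  ultimately show ?thesis using assms(1) by (simp add: bdd_exponents_def exponents_def)
qed

theorem theorem3p5:
  fixes M :: "'a::metric_space measure"
  assumes "metric_measure_space M"
    and "(SUP x. emeasure M (ball x 1)) < \<infinity>"
    and "\<forall>r. 0 < r \<and> r < 1 \<longrightarrow> 0 < (INF x. emeasure M (ball x r))"
  shows "(emeasure M (space M) < \<infinity> \<longleftrightarrow>
      (\<forall>p\<in>bdd_exponents M. \<forall>s\<in>bdd_exponents M. \<forall>q\<in>exponents M.
         compactly_embedded (M_space M s p q) (M_norm M s p q) (Lp_space M p) (Lp_norm M p) \<and>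
         compactly_embedded (N_space M s p q) (N_norm M s p q) (Lp_space M p) (Lp_norm M p)))
    \<and> (emeasure M (space M) < \<infinity> \<longleftrightarrow>
      (\<exists>p\<in>bdd_exponents M. \<exists>s\<in>bdd_exponents M. \<exists>\<beta>\<in>bdd_exponents M. \<exists>q\<in>exponents M.
         (esssup M s < 1 \<and> essinf M q < \<infinity> \<or> esssup M s \<le> 1 \<and> essinf M q = \<infinity>) \<and>
         (compactly_embedded (M_space M s p q) (M_norm M s p q) (Lp_space M \<beta>) (Lp_norm M \<beta>) \<or>
          compactly_embedded (N_space M s p q) (N_norm M s p q) (Lp_space M \<beta>) (Lp_norm M \<beta>))))"
    (is "(?i \<longleftrightarrow> ?ii) \<and> (?i \<longleftrightarrow> ?iii)")
proof -
  note M = assms(1) and m = assms(2) and h = assms(3)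
  have nonnull: "emeasure M (space M) \<noteq> 0"
  proof -
    have "0 < emeasure M (ball undefined 1)" using M by (simp add: metric_measure_space_def)
    also have "\<dots> \<le> emeasure M (space M)" by (intro emeasure_space)
    finally show ?thesis by simp
  qed
  have i_ii: "?i \<Longrightarrow> ?ii"
    by (intro ballI conjI compact_embeddings_if_finite_measure[OF M _ h])
  have ii_iii: "?ii \<Longrightarrow> ?iii"
  proof -
    assume ii: ?ii
    define one half :: "'a \<Rightarrow> ennreal" where "one = (\<lambda>_. 1)" and "half = (\<lambda>_. ennreal (1 / 2))"
    have one: "one \<in> bdd_exponents M" unfolding one_def by (intro const_bdd_exponent) auto
    have "0 < ennreal (1 / 2)" by (subst ennreal_less_zero_iff) simp
    moreover have less_one: "ennreal (1 / 2) < 1"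
      unfolding ennreal_1[symmetric] by (rule ennreal_lessI) auto
    ultimately have half: "half \<in> bdd_exponents M"
      unfolding half_def by (intro const_bdd_exponent order.strict_trans[OF less_one]) auto
    have one': "one \<in> exponents M" using one by (simp add: bdd_exponents_def)
    have "esssup M half < 1"
      unfolding half_def by (rule order.strict_trans1[OF esssup_const_le less_one])
    moreover have "essinf M one < \<infinity>"
      unfolding one_def by (rule order.strict_trans1[OF essinf_const_le[OF nonnull]]) simp
    moreover have "compactly_embedded (M_space M half one one) (M_norm M half one one) (Lp_space M one) (Lp_norm M one)"
      using ii one half one' by blast
    ultimately show ?iii using one half one' by blast
  qed
  have iii_i: "?iii \<Longrightarrow> ?i"
  proof (rule ccontr)
    assume ?iii and "\<not> ?i"
    hence inf: "emeasure M (space M) = \<infinity>" by (simp add: not_less top_unique)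
    have h': "0 < (INF x. emeasure M (ball x (1 / 4)))" using h by simp
    from \<open>?iii\<close> obtain p s \<beta> q where e: "p \<in> bdd_exponents M" "s \<in> bdd_exponents M" "\<beta> \<in> bdd_exponents M" "q \<in> exponents M"
      and cond: "esssup M s < 1 \<or> esssup M s \<le> 1 \<and> essinf M q = \<infinity>"
      and emb: "compactly_embedded (M_space M s p q) (M_norm M s p q) (Lp_space M \<beta>) (Lp_norm M \<beta>) \<or>
          compactly_embedded (N_space M s p q) (N_norm M s p q) (Lp_space M \<beta>) (Lp_norm M \<beta>)" by blast
    obtain C where C: "\<And>a. (\<lambda>x. ereal (bump a x)) \<in> M_space M s p q" "\<And>a. M_norm M s p q (\<lambda>x. ereal (bump a x)) \<le> ennreal C"
      "\<And>a. (\<lambda>x. ereal (bump a x)) \<in> N_space M s p q" "\<And>a. N_norm M s p q (\<lambda>x. ereal (bump a x)) \<le> ennreal C"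
      by (rule bump_in_spaces[OF M m e(1,2,4) cond]) (rule that)
    note not_emb = not_compactly_embedded_if_infinite_measure[OF M m h' inf e(3)]
    from emb show False
    proof
      assume "compactly_embedded (M_space M s p q) (M_norm M s p q) (Lp_space M \<beta>) (Lp_norm M \<beta>)"
      moreover have "\<not> compactly_embedded (M_space M s p q) (M_norm M s p q) (Lp_space M \<beta>) (Lp_norm M \<beta>)"
        by (rule not_emb) (rule C(1), rule C(2))
      ultimately show False by contradiction
    next
      assume "compactly_embedded (N_space M s p q) (N_norm M s p q) (Lp_space M \<beta>) (Lp_norm M \<beta>)"
      moreover have "\<not> compactly_embedded (N_space M s p q) (N_norm M s p q) (Lp_space M \<beta>) (Lp_norm M \<beta>)"
        by (rule not_emb) (rule C(3), rule C(4))
      ultimately show False by contradiction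
    qed
  qed
  show ?thesis
  proof
    show "?i \<longleftrightarrow> ?ii"
    proof
      assume ?i thus ?ii by (rule i_ii)
    next
      assume ?ii thus ?i by (rule iii_i[OF ii_iii])
    qed
    show "?i \<longleftrightarrow> ?iii"
    proof
      assume ?i thus ?iii by (rule ii_iii[OF i_ii])
    next
      assume ?iii thus ?i by (rule iii_i)
    qed
  qed
qed

end
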